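(* Let $q>6.3\cdot 4^{13/3}$ be a prime power and let $f_1,f_2,f_3\in\mathbb{F}_q[X,Y,Z]$ be of degree $3$ with $f_i(0,0,0)=0$. Let $\mathcal{S}_{f_1,f_2,f_3}\subset\mathrm{PG}(6,q)$ be the hypersurface $F(X_0,\dots,X_6)=0$, where $F$ is the homogeneous polynomial whose dehomogenization is \[ F(1,X_1,\dots,X_6)=(X_1-X_4)\big(f_3(X_4,X_5,X_6)-f_3(X_1,X_2,X_3)\big)+(X_2-X_5)\big(f_2(X_4,X_5,X_6)-f_2(X_1,X_2,X_3)\big)+(X_3-X_6)\big(f_1(X_4,X_5,X_6)-f_1(X_1,X_2,X_3)\big). \] If $\mathcal{S}_{f_1,f_2,f_3}$ splits into four hyperplanes, then \[ \mathcal{O}_7(f_1,f_2,f_3)=\{(1,x,y,z,f_1(x,y,z),f_2(x,y,z),f_3(x,y,z),-zf_1(x,y,z)-yf_2(x,y,z)-xf_3(x,y,z)) : x,y,z\in\mathbb{F}_q\}\cup\{(0,0,0,0,0,0,0,1)\} \] is not an ovoid of the hyperbolic quadric $Q: X_0X_7+X_1X_6+X_2X_5+X_3X_4=0$ of $\mathrm{PG}(7,q)$.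
   Context: An ovoid of $Q$ is a set of points of $Q$ meeting every generator (maximal totally singular subspace) of $Q$ in exactly one point. "Splits into four hyperplanes" means $F$ factors over the algebraic closure of $\mathbb{F}_q$ as a product of four linear forms. *)

theory Defs
  imports
    "HOL-Analysis.Cartesian_Space"
    "HOL-Library.Poly_Mapping"
    "HOL-Library.Numeral_Type"
    "HOL-Algebra.Algebraic_Closure_Type"
begin

section \<open>Multivariate polynomials\<close>

text \<open>
  Polynomials in a family of indeterminates indexed by the type \<open>'v\<close>, as finitely supported
  functions from exponent vectors to coefficients. The ring structure is the convolution
  structure of \<^theory>\<open>HOL-Library.Poly_Mapping\<close>.
\<close>

type_synonym ('v, 'a) mpoly = "('v \<Rightarrow>\<^sub>0 nat) \<Rightarrow>\<^sub>0 'a"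

definition mp_const :: "'a \<Rightarrow> ('v, 'a::comm_ring_1) mpoly" where
  "mp_const c = Poly_Mapping.single 0 c"

definition mp_var :: "'v \<Rightarrow> ('v, 'a::comm_ring_1) mpoly" where
  "mp_var v = Poly_Mapping.single (Poly_Mapping.single v 1) 1"

definition mon_degree :: "('v \<Rightarrow>\<^sub>0 nat) \<Rightarrow> nat" where
  "mon_degree m = (\<Sum>v\<in>Poly_Mapping.keys m. Poly_Mapping.lookup m v)"

text \<open>Total degree, with the convention that the zero polynomial has degree 0.\<close>

definition mp_degree :: "('v, 'a::zero) mpoly \<Rightarrow> nat" where
  "mp_degree p = Max (insert 0 (mon_degree ` Poly_Mapping.keys p))"

text \<open>
  The image of \<open>p\<close> under the extension of the coefficient map \<open>h\<close> that sends
  the indeterminate \<open>v\<close> to \<open>\<sigma> v\<close>; evaluation and substitution are the special cases below.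
\<close>

definition mp_hom :: "('a::zero \<Rightarrow> 'b::comm_ring_1) \<Rightarrow> ('v \<Rightarrow> 'b) \<Rightarrow> ('v, 'a) mpoly \<Rightarrow> 'b" where
  "mp_hom h \<sigma> p =
     (\<Sum>m\<in>Poly_Mapping.keys p. h (Poly_Mapping.lookup p m) *
        (\<Prod>v\<in>Poly_Mapping.keys m. \<sigma> v ^ Poly_Mapping.lookup m v))"

definition mp_eval :: "('v \<Rightarrow> 'a) \<Rightarrow> ('v, 'a::comm_ring_1) mpoly \<Rightarrow> 'a" where
  "mp_eval = mp_hom (\<lambda>c. c)"

definition mp_subst :: "('v \<Rightarrow> ('w, 'a) mpoly) \<Rightarrow> ('v, 'a::comm_ring_1) mpoly \<Rightarrow> ('w, 'a) mpoly" where
  "mp_subst = mp_hom mp_const"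

definition mp_homogeneous :: "nat \<Rightarrow> ('v, 'a::zero) mpoly \<Rightarrow> bool" where
  "mp_homogeneous d p \<longleftrightarrow> (\<forall>m\<in>Poly_Mapping.keys p. mon_degree m = d)"

text \<open>
  Homogenization of \<open>p\<close> to its own total degree by means of the indeterminate \<open>v0\<close>,
  which is supposed not to occur in \<open>p\<close>.
\<close>

definition mp_homogenize :: "'v \<Rightarrow> ('v, 'a::comm_ring_1) mpoly \<Rightarrow> ('v, 'a) mpoly" where
  "mp_homogenize v0 p =
     (\<Sum>m\<in>Poly_Mapping.keys p.
        Poly_Mapping.single (m + Poly_Mapping.single v0 (mp_degree p - mon_degree m))
          (Poly_Mapping.lookup p m))"

lemma mon_degree_superset:
  assumes "finite V" "Poly_Mapping.keys m \<subseteq> V"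
  shows "mon_degree m = (\<Sum>v\<in>V. Poly_Mapping.lookup m v)"
  unfolding mon_degree_def
  by (rule sum.mono_neutral_left) (use assms in \<open>auto simp: in_keys_iff\<close>)

lemma mon_degree_single: "mon_degree (Poly_Mapping.single v k) = k"
  by (simp add: mon_degree_def)

lemma mon_degree_add: "mon_degree (m + n) = mon_degree m + mon_degree n"
proof -
  let ?V = "Poly_Mapping.keys m \<union> Poly_Mapping.keys n"
  have "mon_degree (m + n) = (\<Sum>v\<in>?V. Poly_Mapping.lookup (m + n) v)"
    by (rule mon_degree_superset) (auto simp: Poly_Mapping.keys_add)
  also have "\<dots> = (\<Sum>v\<in>?V. Poly_Mapping.lookup m v) + (\<Sum>v\<in>?V. Poly_Mapping.lookup n v)"
    by (simp add: lookup_add sum.distrib)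
  also have "\<dots> = mon_degree m + mon_degree n"
    by (simp add: mon_degree_superset[of ?V])
  finally show ?thesis .
qed

lemma mon_degree_le_mp_degree: "m \<in> Poly_Mapping.keys p \<Longrightarrow> mon_degree m \<le> mp_degree p"
  by (simp add: mp_degree_def)

lemma mp_homogeneous_homogenize: "mp_homogeneous (mp_degree p) (mp_homogenize v0 p)"
  unfolding mp_homogeneous_def
proof
  fix n assume "n \<in> Poly_Mapping.keys (mp_homogenize v0 p)"
  then have "Poly_Mapping.lookup (mp_homogenize v0 p) n \<noteq> 0"
    by (simp add: in_keys_iff)
  then obtain m where m: "m \<in> Poly_Mapping.keys p"
    and "n = m + Poly_Mapping.single v0 (mp_degree p - mon_degree m)"
    unfolding mp_homogenize_def lookup_sum lookup_single
    by (metis (mono_tags, lifting) sum.neutral when_def)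
  with mon_degree_le_mp_degree[OF m] show "mon_degree n = mp_degree p"
    by (simp add: mon_degree_add mon_degree_single)
qed

lemma mp_hom_superset:
  assumes "h 0 = 0" "finite M" "Poly_Mapping.keys p \<subseteq> M"
  shows "mp_hom h \<sigma> p = (\<Sum>m\<in>M. h (Poly_Mapping.lookup p m) *
           (\<Prod>v\<in>Poly_Mapping.keys m. \<sigma> v ^ Poly_Mapping.lookup m v))"
  unfolding mp_hom_def
  by (rule sum.mono_neutral_left) (use assms in \<open>auto simp: in_keys_iff\<close>)

lemma mp_hom_add:
  assumes "h 0 = 0" "\<And>a b. h (a + b) = h a + h b"
  shows "mp_hom h \<sigma> (p + q) = mp_hom h \<sigma> p + mp_hom h \<sigma> q"
proof -
  let ?M = "Poly_Mapping.keys p \<union> Poly_Mapping.keys q"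
  have 1: "Poly_Mapping.keys (p + q) \<subseteq> ?M" by (rule Poly_Mapping.keys_add)
  show ?thesis
    by (simp add: mp_hom_superset[of h ?M] assms 1 lookup_add distrib_right sum.distrib)
qed

lemma mp_hom_sum:
  assumes "h 0 = 0" "\<And>a b. h (a + b) = h a + h b"
  shows "mp_hom h \<sigma> (\<Sum>i\<in>I. g i) = (\<Sum>i\<in>I. mp_hom h \<sigma> (g i))"
proof (induction I rule: infinite_finite_induct)
  case (insert i I)
  then show ?case by (simp add: mp_hom_add assms)
qed (simp_all add: mp_hom_def)

lemma mp_subst_sum: "mp_subst \<sigma> (\<Sum>i\<in>I. g i) = (\<Sum>i\<in>I. mp_subst \<sigma> (g i))"
  unfolding mp_subst_def by (rule mp_hom_sum) (simp_all add: mp_const_def single_add)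

lemma mp_subst_single:
  "mp_subst \<sigma> (Poly_Mapping.single m c) =
     mp_const c * (\<Prod>v\<in>Poly_Mapping.keys m. \<sigma> v ^ Poly_Mapping.lookup m v)"
  by (cases "c = 0") (simp_all add: mp_subst_def mp_hom_def mp_const_def)

lemma mp_var_power: "mp_var v ^ k = Poly_Mapping.single (Poly_Mapping.single v k) 1"
  by (induction k) (simp_all add: mp_var_def mult_single flip: single_add)

lemma prod_single:
  "(\<Prod>v\<in>V. Poly_Mapping.single (g v) (1::'a::comm_ring_1)) = Poly_Mapping.single (\<Sum>v\<in>V. g v) 1"
  by (induction V rule: infinite_finite_induct) (simp_all add: mult_single)

lemma sum_single_keys:
  "(\<Sum>v\<in>Poly_Mapping.keys m. Poly_Mapping.single v (Poly_Mapping.lookup m v)) = m"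
proof (rule poly_mapping_eqI)
  fix k
  show "Poly_Mapping.lookup (\<Sum>v\<in>Poly_Mapping.keys m. Poly_Mapping.single v (Poly_Mapping.lookup m v)) k
        = Poly_Mapping.lookup m k"
    by (simp add: lookup_sum lookup_single when_def in_keys_iff)
qed

lemma dehomogenize_homogenize:
  fixes p :: "('v, 'a::comm_ring_1) mpoly"
  assumes "\<And>m. m \<in> Poly_Mapping.keys p \<Longrightarrow> v0 \<notin> Poly_Mapping.keys m"
  shows "mp_subst (mp_var(v0 := 1)) (mp_homogenize v0 p) = p"
proof -
  have *: "mp_subst (mp_var(v0 := 1)) (Poly_Mapping.single (m + Poly_Mapping.single v0 k) c)
        = Poly_Mapping.single m c" if "v0 \<notin> Poly_Mapping.keys m" for m k and c :: 'a
  proof -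
    let ?n = "m + Poly_Mapping.single v0 k"
    let ?t = "\<lambda>v. ((mp_var(v0 := 1)) v :: ('v, 'a) mpoly) ^ Poly_Mapping.lookup ?n v"
    have "(\<Prod>v\<in>Poly_Mapping.keys ?n. ?t v) = (\<Prod>v\<in>insert v0 (Poly_Mapping.keys m). ?t v)"
    proof (rule prod.mono_neutral_left)
      show "Poly_Mapping.keys ?n \<subseteq> insert v0 (Poly_Mapping.keys m)"
        using Poly_Mapping.keys_add[of m "Poly_Mapping.single v0 k"]
        by (auto split: if_splits)
    qed (auto simp: in_keys_iff)
    also have "\<dots> = (\<Prod>v\<in>Poly_Mapping.keys m. ?t v)"
      using that by simp
    also have "\<dots> = (\<Prod>v\<in>Poly_Mapping.keys m.
        Poly_Mapping.single (Poly_Mapping.single v (Poly_Mapping.lookup m v)) 1)"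
      by (rule prod.cong) (use that in \<open>auto simp: lookup_add lookup_single when_def mp_var_power\<close>)
    also have "\<dots> = Poly_Mapping.single m 1"
      by (simp add: prod_single sum_single_keys)
    finally show ?thesis
      by (simp add: mp_subst_single mp_const_def mult_single)
  qed
  have "mp_subst (mp_var(v0 := 1)) (mp_homogenize v0 p)
      = (\<Sum>m\<in>Poly_Mapping.keys p. Poly_Mapping.single m (Poly_Mapping.lookup p m))"
    unfolding mp_homogenize_def mp_subst_sum by (rule sum.cong) (simp_all add: * assms)
  then show ?thesis by (simp add: sum_single_keys)
qed

definition linear_form :: "('v::finite, 'a::comm_ring_1) mpoly \<Rightarrow> bool" where
  "linear_form L \<longleftrightarrow> (\<exists>a. L = (\<Sum>v\<in>UNIV. mp_const (a v) * mp_var v))"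


section \<open>The hypersurface\<close>

text \<open>
  Indeterminates \<open>X, Y, Z\<close> are indexed by \<open>0, 1, 2 :: 3\<close> and \<open>X\<^sub>0, \<dots>, X\<^sub>6\<close> by
  \<open>0, \<dots>, 6 :: 7\<close>.
\<close>

definition triple :: "'b \<Rightarrow> 'b \<Rightarrow> 'b \<Rightarrow> 3 \<Rightarrow> 'b" where
  "triple x y z i = (if i = 0 then x else if i = 1 then y else z)"

text \<open>\<open>S_diff g\<close> is \<open>g(X\<^sub>4, X\<^sub>5, X\<^sub>6) - g(X\<^sub>1, X\<^sub>2, X\<^sub>3)\<close>.\<close>

definition S_diff :: "(3, 'a) mpoly \<Rightarrow> (7, 'a::comm_ring_1) mpoly" where
  "S_diff g =
     mp_subst (triple (mp_var 4) (mp_var 5) (mp_var 6)) g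
     - mp_subst (triple (mp_var 1) (mp_var 2) (mp_var 3)) g"

definition S_affine ::
    "(3, 'a) mpoly \<Rightarrow> (3, 'a) mpoly \<Rightarrow> (3, 'a) mpoly \<Rightarrow> (7, 'a::comm_ring_1) mpoly" where
  "S_affine f1 f2 f3 =
     (mp_var 1 - mp_var 4) * S_diff f3
     + (mp_var 2 - mp_var 5) * S_diff f2
     + (mp_var 3 - mp_var 6) * S_diff f1"

definition S_form ::
    "(3, 'a) mpoly \<Rightarrow> (3, 'a) mpoly \<Rightarrow> (3, 'a) mpoly \<Rightarrow> (7, 'a::comm_ring_1) mpoly" where
  "S_form f1 f2 f3 = mp_homogenize 0 (S_affine f1 f2 f3)"

definition splits_into_four_hyperplanes :: "('v::finite, 'a::field) mpoly \<Rightarrow> bool" where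
  "splits_into_four_hyperplanes F \<longleftrightarrow>
     (\<exists>L1 L2 L3 L4 :: ('v, 'a alg_closure) mpoly.
        linear_form L1 \<and> linear_form L2 \<and> linear_form L3 \<and> linear_form L4 \<and>
        Poly_Mapping.map to_ac F = L1 * L2 * L3 * L4)"


section \<open>Quadrics and ovoids\<close>

text \<open>
  Points of the projective space are the one-dimensional subspaces of the underlying vector
  space; a quadric is given by its quadratic form \<open>Q\<close>.
\<close>

definition pg_points :: "('a::field ^ 'n) set set" where
  "pg_points = {vec.span {v} | v. v \<noteq> 0}"

definition totally_singular :: "('a::field ^ 'n \<Rightarrow> 'a) \<Rightarrow> ('a ^ 'n) set \<Rightarrow> bool" where
  "totally_singular Q W \<longleftrightarrow> vec.subspace W \<and> (\<forall>w\<in>W. Q w = 0)"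

definition quadric_generator :: "('a::field ^ 'n \<Rightarrow> 'a) \<Rightarrow> ('a ^ 'n) set \<Rightarrow> bool" where
  "quadric_generator Q W \<longleftrightarrow>
     totally_singular Q W \<and> (\<forall>W'. totally_singular Q W' \<and> W \<subseteq> W' \<longrightarrow> W' = W)"

definition quadric_points :: "('a::field ^ 'n \<Rightarrow> 'a) \<Rightarrow> ('a ^ 'n) set set" where
  "quadric_points Q = {P \<in> pg_points. \<forall>v\<in>P. Q v = 0}"

definition is_ovoid :: "('a::field ^ 'n \<Rightarrow> 'a) \<Rightarrow> ('a ^ 'n) set set \<Rightarrow> bool" where
  "is_ovoid Q Ov \<longleftrightarrow>
     Ov \<subseteq> quadric_points Q \<and> (\<forall>W. quadric_generator Q W \<longrightarrow> (\<exists>!P. P \<in> Ov \<and> P \<subseteq> W))"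

text \<open>Coordinates \<open>X\<^sub>0, \<dots>, X\<^sub>7\<close> are indexed by \<open>0, \<dots>, 7 :: 8\<close>.\<close>

definition Q7 :: "'a::field ^ 8 \<Rightarrow> 'a" where
  "Q7 v = v $ 0 * v $ 7 + v $ 1 * v $ 6 + v $ 2 * v $ 5 + v $ 3 * v $ 4"

definition vec8 :: "'a \<Rightarrow> 'a \<Rightarrow> 'a \<Rightarrow> 'a \<Rightarrow> 'a \<Rightarrow> 'a \<Rightarrow> 'a \<Rightarrow> 'a \<Rightarrow> 'a ^ 8" where
  "vec8 a0 a1 a2 a3 a4 a5 a6 a7 =
     (\<chi> i. if i = 0 then a0 else if i = 1 then a1 else if i = 2 then a2 else if i = 3 then a3
           else if i = 4 then a4 else if i = 5 then a5 else if i = 6 then a6 else a7)"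

definition O7 ::
    "(3, 'a) mpoly \<Rightarrow> (3, 'a) mpoly \<Rightarrow> (3, 'a) mpoly \<Rightarrow> ('a::field ^ 8) set set" where
  "O7 f1 f2 f3 =
     {vec.span {vec8 1 x y z
        (mp_eval (triple x y z) f1) (mp_eval (triple x y z) f2) (mp_eval (triple x y z) f3)
        (- z * mp_eval (triple x y z) f1 - y * mp_eval (triple x y z) f2
           - x * mp_eval (triple x y z) f3)} | x y z. True}
     \<union> {vec.span {vec8 0 0 0 0 0 0 0 1}}"

end

theory Submission
  imports Defs
begin

text \<open>
  Two points of the set given by \<open>x, y \<in> \<bbbF>\<^sub>q\<^sup>3\<close> are orthogonal iff \<open>F(1, x, y) = 0\<close>, and orthogonal
  points lie in a common generator. So it suffices to find a rational zero of \<open>F\<close> with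
  \<open>x \<noteq> y\<close>. Since \<open>F\<close> vanishes on the diagonal \<open>x = y\<close>, so does one of the four linear factors, that is,
  it is a linear form in \<open>x - y\<close>; and the Frobenius map permutes the factors up to scalars, preserving
  this property.

  If exactly one factor does not vanish on the diagonal, it is rational, and it is not \<open>X\<^sub>0\<close>, so it has
  rational affine zeros off the diagonal. If at most two factors vanish on the diagonal, they are
  defined over \<open>\<bbbF>\<^bsub>q^2\<^esub>\<close>, so they have nonzero rational zeros in the three variables \<open>x - y\<close>. If all
  factors vanish on the diagonal, then \<open>F(1, x, y) = N(x - y)\<close> for a quartic form \<open>N\<close>. By the shape of
  \<open>F\<close> the part of bidegree \<open>(2, 2)\<close> of \<open>N(x - y)\<close> is zero, which forces any three of the factors to
  be linearly dependent. Hence the factors are either all proportional to a rational one, or they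
  have a unique common zero in the projective plane, which is then rational.
\<close>

section \<open>The Frobenius map\<close>

text \<open>Over a finite field, the product of all \<open>X - a\<close> plus 1 has positive degree
  but no root.\<close>

lemma infinite_alg_closed: "infinite (UNIV :: 'k::alg_closed_field set)"
proof
  assume fin: "finite (UNIV :: 'k set)"
  define p :: "'k poly" where "p = (\<Prod>a\<in>UNIV. [:-a, 1:])"
  have dp: "degree p = card (UNIV :: 'k set)"
    unfolding p_def by (subst degree_prod_eq_sum_degree) auto
  have pos: "card (UNIV :: 'k set) > 0"
    using fin by (simp add: card_gt_0_iff)
  have "degree (p + 1) = degree p"
    by (rule degree_add_eq_left) (use dp pos in simp)
  then have "degree (p + 1) > 0" using dp pos by simp
  then obtain x where "poly (p + 1) x = 0" using alg_closed_imp_poly_has_root by blast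
  moreover have "poly p x = 0"
    unfolding p_def poly_prod using fin by (simp add: prod_zero_iff)
  ultimately show False by simp
qed

text \<open>Multiplication by a nonzero \<open>x\<close> permutes the nonzero elements; comparing
  their products gives \<open>x ^ (q - 1) = 1\<close>.\<close>

lemma power_card_eq_same:
  fixes x :: "'a::{field,finite}"
  shows "x ^ CARD('a) = x"
proof (cases "x = 0")
  case False
  have "(\<Prod>y\<in>UNIV-{0}. x * y) = (\<Prod>y\<in>UNIV-{0}. y)"
    by (rule prod.reindex_bij_witness[of _ "\<lambda>y. y / x" "\<lambda>y. x * y"]) (use False in auto)
  then have "x ^ (CARD('a) - 1) = 1"
    by (simp add: prod.distrib)
  then show ?thesis
    by (metis One_nat_def Suc_pred mult.right_neutral power_Suc zero_less_card_finite)
qed simp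

text \<open>On the field itself \<open>(x + 1) ^ q = x + 1 = x ^ q + 1\<close>, so the polynomial
  formed by the middle binomial terms has degree below q and vanishes at all q elements. Hence it is
  zero; the argument never mentions the characteristic.\<close>

lemma of_nat_card_choose_eq_0:
  assumes "0 < k" "k < CARD('a::{field,finite})"
  shows "of_nat (CARD('a) choose k) = (0::'a)"
proof -
  define q where "q = CARD('a)"
  define p :: "'a poly" where "p = (\<Sum>j\<in>{1..<q}. monom (of_nat (q choose j)) j)"
  have "poly p x = 0" for x
  proof -
    have "{..q} = {1..<q} \<union> {0,q}" using assms q_def by auto
    then have "(x + 1) ^ q = (\<Sum>j\<in>{1..<q} \<union> {0,q}. of_nat (q choose j) * x ^ j)"
      by (simp add: binomial_ring)
    also have "\<dots> = (\<Sum>j\<in>{1..<q}. of_nat (q choose j) * x ^ j) + (1 + x ^ q)"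
      using assms by (subst sum.union_disjoint) (auto simp: q_def)
    finally show ?thesis
      by (simp add: p_def poly_sum poly_monom q_def power_card_eq_same)
  qed
  then have roots: "{x. poly p x = 0} = UNIV" by simp
  have "degree p < q"
    unfolding p_def using assms
    by (intro degree_sum_less) (auto simp: q_def intro: le_less_trans[OF degree_monom_le])
  then have "p = 0"
    using card_poly_roots_bound[of p] roots q_def by fastforce
  then have "coeff p k = 0" by simp
  then show ?thesis
    using assms by (simp add: p_def coeff_sum q_def)
qed

text \<open>The middle binomial coefficients vanish in \<open>'a\<close>, hence also in the closure,
  by applying \<open>to_ac\<close>.\<close>

lemma card_power_add:
  fixes x y :: "'a::{field,finite} alg_closure"
  shows "(x + y) ^ CARD('a) = x ^ CARD('a) + y ^ CARD('a)"
proof -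
  let ?q = "CARD('a)"
  have "(x + y) ^ ?q = (\<Sum>k\<le>?q. of_nat (?q choose k) * x ^ k * y ^ (?q - k))"
    by (rule binomial_ring)
  also have "\<dots> = (\<Sum>k\<in>{0,?q}. of_nat (?q choose k) * x ^ k * y ^ (?q - k))"
  proof (rule sum.mono_neutral_right)
    show "\<forall>k\<in>{..?q} - {0, ?q}. of_nat (?q choose k) * x ^ k * y ^ (?q - k) = 0"
    proof
      fix k assume "k \<in> {..?q} - {0, ?q}"
      then have "of_nat (?q choose k) = (0::'a)"
        by (intro of_nat_card_choose_eq_0) auto
      then have "to_ac (of_nat (?q choose k) :: 'a) = 0" by simp
      then show "of_nat (?q choose k) * x ^ k * y ^ (?q - k) = 0"
        by (simp del: to_ac_eq_0_iff)
    qed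
  qed auto
  finally show ?thesis by simp
qed

lemma card_power_sum:
  fixes f :: "'b \<Rightarrow> 'a::{field,finite} alg_closure"
  shows "(\<Sum>i\<in>I. f i) ^ CARD('a) = (\<Sum>i\<in>I. f i ^ CARD('a))"
  by (induction I rule: infinite_finite_induct) (simp_all add: card_power_add)

lemma card_power_eq_iff:
  fixes x y :: "'a::{field,finite} alg_closure"
  shows "x ^ CARD('a) = y ^ CARD('a) \<longleftrightarrow> x = y"
proof
  assume "x ^ CARD('a) = y ^ CARD('a)"
  then have "(x - y) ^ CARD('a) = 0"
    using card_power_add[of "x - y" y] by simp
  then show "x = y" by simp
qed simp

lemma card_power_surj: "\<exists>y::'a::{field,finite} alg_closure. x = y ^ CARD('a)"
  using nth_root_exists[of "CARD('a)" x] by (metis zero_less_card_finite)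

lemma card_fixed_points_power:
  assumes "1 < n"
  shows "finite {x::'k::idom. x ^ n = x}" "card {x::'k::idom. x ^ n = x} \<le> n"
proof -
  define p :: "'k poly" where "p = monom 1 n - monom 1 1"
  have "coeff p n = 1" using assms by (simp add: p_def)
  then have "p \<noteq> 0" by auto
  moreover have "degree p \<le> n"
    unfolding p_def by (rule degree_diff_le) (use assms in \<open>auto simp: degree_monom_eq\<close>)
  moreover have "{x. poly p x = 0} = {x. x ^ n = x}"
    by (simp add: p_def poly_monom)
  ultimately show "finite {x::'k. x ^ n = x}" "card {x::'k. x ^ n = x} \<le> n"
    using poly_roots_finite[of p] card_poly_roots_bound[of p] by auto
qed

lemma card_field_gt_1: "1 < CARD('a::{field,finite})"
proof -
  have "card {0, 1::'a} \<le> CARD('a)" by (rule card_mono) auto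
  then show ?thesis by simp
qed

text \<open>The image of \<open>to_ac\<close> supplies q roots of \<open>x ^ q = x\<close>, and
  there are at most q of them.\<close>

lemma power_card_fixed_imp_range_to_ac:
  fixes x :: "'a::{field,finite} alg_closure"
  assumes "x ^ CARD('a) = x"
  shows "x \<in> range (to_ac :: 'a \<Rightarrow> _)"
proof -
  let ?S = "{x :: 'a alg_closure. x ^ CARD('a) = x}"
  have "range (to_ac :: 'a \<Rightarrow> _) = ?S"
  proof (rule card_seteq)
    show "range (to_ac :: 'a \<Rightarrow> _) \<subseteq> ?S"
      by (auto simp flip: to_ac_power simp: power_card_eq_same)
    show "card ?S \<le> card (range (to_ac :: 'a \<Rightarrow> _))"
      using card_fixed_points_power(2)[OF card_field_gt_1, where 'k = "'a alg_closure"]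
      by (simp add: card_image inj_to_ac)
  qed (rule card_fixed_points_power[OF card_field_gt_1])
  then show ?thesis using assms by auto
qed

section \<open>Evaluation of multivariate polynomials\<close>

definition monomial_value :: "('v \<Rightarrow> 'b::comm_ring_1) \<Rightarrow> ('v \<Rightarrow>\<^sub>0 nat) \<Rightarrow> 'b" where
  "monomial_value \<sigma> m = (\<Prod>v\<in>Poly_Mapping.keys m. \<sigma> v ^ Poly_Mapping.lookup m v)"

lemma monomial_value_superset:
  assumes "finite V" "Poly_Mapping.keys m \<subseteq> V"
  shows "monomial_value \<sigma> m = (\<Prod>v\<in>V. \<sigma> v ^ Poly_Mapping.lookup m v)"
  unfolding monomial_value_def
  by (rule prod.mono_neutral_left) (use assms in \<open>auto simp: in_keys_iff\<close>)

lemma monomial_value_add: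
  "monomial_value \<sigma> (m + n) = monomial_value \<sigma> m * monomial_value \<sigma> n"
proof -
  let ?V = "Poly_Mapping.keys m \<union> Poly_Mapping.keys n"
  have "Poly_Mapping.keys (m + n) \<subseteq> ?V" by (rule Poly_Mapping.keys_add)
  then show ?thesis
    by (simp add: monomial_value_superset[of ?V] lookup_add power_add prod.distrib)
qed

lemma monomial_value_single: "monomial_value \<sigma> (Poly_Mapping.single v k) = \<sigma> v ^ k"
  by (simp add: monomial_value_def)

lemma mp_hom_monomial_value:
  "mp_hom h \<sigma> p =
     (\<Sum>m\<in>Poly_Mapping.keys p. h (Poly_Mapping.lookup p m) * monomial_value \<sigma> m)"
  by (simp add: mp_hom_def monomial_value_def)

lemma mp_hom_single:
  assumes "h 0 = 0"
  shows "mp_hom h \<sigma> (Poly_Mapping.single m c) = h c * monomial_value \<sigma> m"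
  using assms by (cases "c = 0") (simp_all add: mp_hom_monomial_value)

text \<open>Two instances are used: the identity, for values over the coefficient ring itself, and
  \<open>to_ac\<close>, for values of a polynomial over \<open>'a\<close> at points of the
  closure.\<close>

locale coeff_hom =
  fixes h :: "'a::comm_ring_1 \<Rightarrow> 'b::comm_ring_1"
  assumes h_0: "h 0 = 0" and h_1: "h 1 = 1"
    and h_add: "\<And>a b. h (a + b) = h a + h b"
    and h_mult: "\<And>a b. h (a * b) = h a * h b"
begin

lemma hom_add: "mp_hom h \<sigma> (p + r) = mp_hom h \<sigma> p + mp_hom h \<sigma> r"
  by (rule mp_hom_add) (simp_all add: h_0 h_add)

lemma hom_sum: "mp_hom h \<sigma> (\<Sum>i\<in>I. g i) = (\<Sum>i\<in>I. mp_hom h \<sigma> (g i))"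
  by (rule mp_hom_sum) (simp_all add: h_0 h_add)

lemma hom_diff: "mp_hom h \<sigma> (p - r) = mp_hom h \<sigma> p - mp_hom h \<sigma> r"
  using hom_add[of \<sigma> "p - r" r] by simp

lemma hom_mult: "mp_hom h \<sigma> (p * r) = mp_hom h \<sigma> p * mp_hom h \<sigma> r"
proof -
  let ?s = "\<lambda>p m. Poly_Mapping.single m (Poly_Mapping.lookup p m)"
  have "p * r = (\<Sum>m\<in>Poly_Mapping.keys p. ?s p m) * (\<Sum>n\<in>Poly_Mapping.keys r. ?s r n)"
    by (simp add: sum_single_keys)
  also have "\<dots> = (\<Sum>m\<in>Poly_Mapping.keys p. \<Sum>n\<in>Poly_Mapping.keys r.
      Poly_Mapping.single (m + n) (Poly_Mapping.lookup p m * Poly_Mapping.lookup r n))"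
    by (simp add: sum_product mult_single)
  finally have "mp_hom h \<sigma> (p * r) = (\<Sum>m\<in>Poly_Mapping.keys p. \<Sum>n\<in>Poly_Mapping.keys r.
      (h (Poly_Mapping.lookup p m) * monomial_value \<sigma> m) *
      (h (Poly_Mapping.lookup r n) * monomial_value \<sigma> n))"
    by (simp add: hom_sum mp_hom_single h_0 h_mult monomial_value_add mult_ac)
  then show ?thesis
    by (simp add: mp_hom_monomial_value sum_product)
qed

lemma hom_const: "mp_hom h \<sigma> (mp_const c) = h c"
  by (simp add: mp_const_def mp_hom_single h_0 monomial_value_def)

lemma hom_var: "mp_hom h \<sigma> (mp_var v) = \<sigma> v"
  by (simp add: mp_var_def mp_hom_single h_0 h_1 monomial_value_single)

lemma hom_prod: "mp_hom h \<sigma> (\<Prod>i\<in>I. g i) = (\<Prod>i\<in>I. mp_hom h \<sigma> (g i))"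
proof -
  have "mp_hom h \<sigma> 1 = 1" using hom_const[of \<sigma> 1] by (simp add: mp_const_def h_1)
  then show ?thesis
    by (induction I rule: infinite_finite_induct) (simp_all add: hom_mult)
qed

lemma hom_power: "mp_hom h \<sigma> (p ^ n) = mp_hom h \<sigma> p ^ n"
  using hom_prod[of \<sigma> "\<lambda>_. p" "{..<n}"] by simp

lemma hom_subst: "mp_hom h \<sigma> (mp_subst \<tau> p) = mp_hom h (\<lambda>v. mp_hom h \<sigma> (\<tau> v)) p"
  unfolding mp_subst_def mp_hom_def[of mp_const] mp_hom_def[of h "\<lambda>v. mp_hom h \<sigma> (\<tau> v)"]
  by (simp add: hom_sum hom_mult hom_const hom_prod hom_power)

lemma hom_homogenize:
  assumes "\<sigma> v0 = 1"
  shows "mp_hom h \<sigma> (mp_homogenize v0 p) = mp_hom h \<sigma> p"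
  unfolding mp_homogenize_def mp_hom_monomial_value[of h \<sigma> p]
  by (simp add: hom_sum mp_hom_single h_0 monomial_value_add monomial_value_single assms)

lemma hom_comp: "mp_hom h (h \<circ> \<sigma>) p = h (mp_hom (\<lambda>c. c) \<sigma> p)"
proof -
  have s: "h (sum g I) = (\<Sum>i\<in>I. h (g i))" for g :: "'d \<Rightarrow> 'a" and I
    by (induction I rule: infinite_finite_induct) (simp_all add: h_0 h_add)
  have m: "h (prod g I) = (\<Prod>i\<in>I. h (g i))" for g :: "'d \<Rightarrow> 'a" and I
    by (induction I rule: infinite_finite_induct) (simp_all add: h_1 h_mult)
  have w: "h (c ^ n) = h c ^ n" for c n
    using m[of "\<lambda>_. c" "{..<n}"] by simp
  show ?thesis
    by (simp add: mp_hom_def s m w h_mult)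
qed

end

interpretation to_ac: coeff_hom to_ac
  by standard auto

interpretation id: coeff_hom "\<lambda>c. c"
  by standard auto

lemma linear_form_eval:
  assumes "linear_form L"
  shows "\<exists>a. L = (\<Sum>v\<in>UNIV. mp_const (a v) * mp_var v) \<and>
     (\<forall>\<sigma>. mp_hom (\<lambda>c. c) \<sigma> L = (\<Sum>v\<in>UNIV. a v * \<sigma> v))"
  using assms unfolding linear_form_def
  by (auto simp: id.hom_sum id.hom_mult id.hom_const id.hom_var)

lemma keys_map_to_ac: "Poly_Mapping.keys (Poly_Mapping.map to_ac p) = Poly_Mapping.keys p"
  by (auto simp: in_keys_iff map.rep_eq when_def)

lemma mp_hom_map_to_ac: "mp_hom (\<lambda>c. c) \<sigma> (Poly_Mapping.map to_ac p) = mp_hom to_ac \<sigma> p"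
  unfolding mp_hom_def keys_map_to_ac
  by (intro sum.cong) (auto simp: map.rep_eq when_def in_keys_iff)

text \<open>Frobenius is additive and multiplicative and fixes the coefficients, which come from
  \<open>'a\<close>. This is the source of its action on the linear factors of F.\<close>

lemma mp_hom_to_ac_card_power:
  fixes p :: "('v, 'a::{field,finite}) mpoly"
  shows "mp_hom to_ac (\<lambda>v. \<sigma> v ^ CARD('a)) p = mp_hom to_ac \<sigma> p ^ CARD('a)"
proof -
  have *: "(x ^ n) ^ k = (x ^ k) ^ n" for x :: "'a alg_closure" and n k
    by (simp add: mult.commute flip: power_mult)
  show ?thesis
    by (simp add: mp_hom_def card_power_sum power_mult_distrib prod_power_distrib *[of _ "CARD('a)"])
      (simp add: power_card_eq_same flip: to_ac_power)
qed

lemma UNIV_7: "UNIV = {0, 1, 2, 3, 4, 5, 6 :: 7}"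
  by (rule card_seteq[symmetric]) simp_all

lemma UNIV_3_from_0: "UNIV = {0, 1, 2 :: 3}"
  by (rule card_seteq[symmetric]) simp_all

section \<open>Linear forms\<close>

definition pairing :: "('v::finite \<Rightarrow> 'k::comm_ring_1) \<Rightarrow> ('v \<Rightarrow> 'k) \<Rightarrow> 'k" where
  "pairing a v = (\<Sum>i\<in>UNIV. a i * v i)"

lemma pairing_add_scale: "pairing a (\<lambda>i. v i + t * w i) = pairing a v + t * pairing a w"
  by (simp add: pairing_def distrib_left sum.distrib sum_distrib_left mult_ac)

lemma pairing_indicator: "pairing a (\<lambda>j. if j = i then c else 0) = a i * c"
  by (simp add: pairing_def if_distrib[of "\<lambda>x. _ * x"] cong: if_cong)

text \<open>All 2 by 2 minors vanish. The zero vector is proportional to everything, so transitivity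
  needs a nonzero middle vector.\<close>

definition proportional :: "('v \<Rightarrow> 'k::comm_ring_1) \<Rightarrow> ('v \<Rightarrow> 'k) \<Rightarrow> bool" where
  "proportional a b \<longleftrightarrow> (\<forall>i j. a i * b j = a j * b i)"

lemma proportional_sym: "proportional a b \<Longrightarrow> proportional b a"
  unfolding proportional_def by (metis mult.commute)

lemma proportional_scale:
  fixes a b :: "'v \<Rightarrow> 'k::field"
  assumes "proportional a b" "a \<noteq> (\<lambda>_. 0)"
  shows "\<exists>c. b = (\<lambda>i. c * a i)"
proof -
  obtain j where j: "a j \<noteq> 0" using assms(2) by auto
  have "b i = b j / a j * a i" for i
    using assms(1) j by (simp add: proportional_def field_simps)
  then show ?thesis by blast
qed

lemma proportional_trans:
  fixes a b c :: "'v \<Rightarrow> 'k::field"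
  assumes "proportional a b" "proportional b c" "b \<noteq> (\<lambda>_. 0)"
  shows "proportional a c"
proof -
  obtain s where "a = (\<lambda>i. s * b i)"
    using proportional_scale[OF proportional_sym[OF assms(1)] assms(3)] by blast
  moreover obtain t where "c = (\<lambda>i. t * b i)"
    using proportional_scale[OF assms(2,3)] by blast
  ultimately show ?thesis by (simp add: proportional_def mult_ac)
qed

lemma pairing_proportional:
  fixes a b :: "'v::finite \<Rightarrow> 'k::field"
  assumes "proportional a b" "a \<noteq> (\<lambda>_. 0)" "pairing a v = 0"
  shows "pairing b v = 0"
proof -
  obtain c where "b = (\<lambda>i. c * a i)" using proportional_scale[OF assms(1,2)] by blast
  then have "pairing b v = c * pairing a v"
    by (simp add: pairing_def sum_distrib_left mult_ac)
  then show ?thesis using assms(3) by simp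
qed

text \<open>The vector with entry \<open>a i\<close> at \<open>j\<close> and \<open>- a j\<close> at
  \<open>i\<close> lies in the kernel of \<open>a\<close>; that \<open>b\<close> kills it is the
  minor condition at \<open>i\<close>, \<open>j\<close>.\<close>

lemma proportional_if_kernel_subset:
  fixes a b :: "'v::finite \<Rightarrow> 'k::field"
  assumes "\<And>v. pairing a v = 0 \<Longrightarrow> pairing b v = 0"
  shows "proportional a b"
  unfolding proportional_def
proof (intro allI)
  fix i j
  let ?v = "\<lambda>k. (if k = j then a i else 0) + (- a j) * (if k = i then 1 else 0)"
  have "pairing a ?v = 0"
    by (simp only: pairing_add_scale pairing_indicator) simp
  then have "pairing b ?v = 0" by (rule assms)
  then show "a i * b j = a j * b i"
    by (simp only: pairing_add_scale pairing_indicator) (simp add: mult.commute)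
qed

text \<open>Induction on the set of forms. On the line \<open>v + t w\<close>, with \<open>v\<close>
  good for the old forms and \<open>w\<close> for the new one, each form vanishes for at most one
  \<open>t\<close>, so an infinite field leaves a good parameter.\<close>

lemma linear_space_not_union_of_kernels:
  fixes a :: "'i \<Rightarrow> 'v::finite \<Rightarrow> 'k::field"
  assumes inf: "infinite (UNIV :: 'k set)" and "finite I" and "V \<noteq> {}"
    and V: "\<And>v w t. v \<in> V \<Longrightarrow> w \<in> V \<Longrightarrow> (\<lambda>i. v i + t * w i) \<in> V"
    and "\<And>i. i \<in> I \<Longrightarrow> \<exists>v\<in>V. pairing (a i) v \<noteq> 0"
  shows "\<exists>v\<in>V. \<forall>i\<in>I. pairing (a i) v \<noteq> 0"
  using assms(2,5)
proof (induction I)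
  case (insert k I)
  then obtain v where v: "v \<in> V" "\<forall>i\<in>I. pairing (a i) v \<noteq> 0" by auto
  obtain w where w: "w \<in> V" "pairing (a k) w \<noteq> 0" using insert.prems by auto
  define T where "T i = {t. pairing (a i) v + t * pairing (a i) w = 0}" for i
  have "finite (T i)" if "i \<in> insert k I" for i
  proof (cases "pairing (a i) w = 0")
    case True
    then have "T i = {}" using that v w by (auto simp: T_def)
    then show ?thesis by simp
  next
    case False
    then have "T i \<subseteq> {- pairing (a i) v / pairing (a i) w}"
      by (auto simp: T_def field_simps add_eq_0_iff2)
    then show ?thesis by (rule finite_subset) simp
  qed
  then have "finite (\<Union>i\<in>insert k I. T i)" using insert.hyps by blast
  then obtain t where "t \<notin> (\<Union>i\<in>insert k I. T i)" using inf ex_new_if_finite by blast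
  then have "\<forall>i\<in>insert k I. pairing (a i) (\<lambda>i. v i + t * w i) \<noteq> 0"
    by (simp add: T_def pairing_add_scale)
  then show ?case using V v(1) w(1) by blast
qed (use assms(3) in blast)

section \<open>Frobenius conjugates of linear forms\<close>

definition conj_form :: "('v \<Rightarrow> 'a::{field,finite} alg_closure) \<Rightarrow> 'v \<Rightarrow> 'a alg_closure" where
  "conj_form a = (\<lambda>i. a i ^ CARD('a))"

text \<open>Conjugating both the form and the point raises the value to the power q, so the kernel
  of a conjugate form is the conjugate of the kernel.\<close>

lemma pairing_conj:
  fixes a :: "'v::finite \<Rightarrow> 'a::{field,finite} alg_closure"
  shows "pairing (conj_form a) (conj_form v) = pairing a v ^ CARD('a)"
  by (simp add: pairing_def conj_form_def card_power_sum power_mult_distrib)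

lemma conj_form_surj:
  fixes v :: "'v \<Rightarrow> 'b::{field,finite} alg_closure"
  shows "\<exists>w. v = conj_form w"
proof -
  obtain w where "\<forall>i. v i = w i ^ CARD('b)"
    using choice[of "\<lambda>i y. v i = y ^ CARD('b)"] card_power_surj by blast
  then show ?thesis unfolding conj_form_def by (intro exI[of _ w]) auto
qed

lemma conj_form_eq_zero_iff: "conj_form a = (\<lambda>_. 0) \<longleftrightarrow> a = (\<lambda>_. 0)"
  by (simp add: conj_form_def fun_eq_iff)

lemma proportional_conj_iff: "proportional (conj_form a) (conj_form b) \<longleftrightarrow> proportional a b"
  by (simp add: proportional_def conj_form_def card_power_eq_iff flip: power_mult_distrib)

text \<open>Dividing by a nonzero entry removes the scalar, so all quotients are fixed by Frobenius
  and lie in the base field.\<close>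

lemma proportional_conj_imp_rational:
  fixes a :: "'v \<Rightarrow> 'a::{field,finite} alg_closure"
  assumes "proportional a (conj_form a)" "a \<noteq> (\<lambda>_. 0)"
  shows "\<exists>c b. c \<noteq> 0 \<and> a = (\<lambda>i. c * to_ac (b i))"
proof -
  obtain j where j: "a j \<noteq> 0" using assms(2) by auto
  have "(a i / a j) ^ CARD('a) = a i / a j" for i
    using assms(1) j by (simp add: proportional_def conj_form_def power_divide field_simps)
  then have "\<exists>b. to_ac b = a i / a j" for i
    using power_card_fixed_imp_range_to_ac by (metis image_iff)
  then obtain b where "\<And>i. to_ac (b i) = a i / a j" by metis
  then have "a = (\<lambda>i. a j * to_ac (b i))" using j by auto
  then show ?thesis using j by blast
qed

text \<open>
  The coefficients of a form defined over the quadratic extension, suitably normalised, lie among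
  the at most \<open>q\<^sup>2\<close> roots of \<open>x ^ q\<^sup>2 = x\<close>, whereas the form has \<open>q\<^sup>3\<close> rational arguments.
\<close>

lemma quadratic_form_rational_zero:
  fixes a :: "3 \<Rightarrow> 'a::{field,finite} alg_closure"
  assumes "proportional a (conj_form (conj_form a))"
  shows "\<exists>u :: 3 \<Rightarrow> 'a. u \<noteq> (\<lambda>_. 0) \<and> pairing a (to_ac \<circ> u) = 0"
proof (cases "a = (\<lambda>_. 0)")
  case True
  then show ?thesis by (intro exI[of _ "\<lambda>_. 1"]) (auto simp: pairing_def fun_eq_iff)
next
  case False
  then obtain j where j: "a j \<noteq> 0" by auto
  define q where "q = CARD('a)"
  define b where "b i = a i / a j" for i
  define S where "S = {x :: 'a alg_closure. x ^ (q ^ 2) = x}"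
  have q: "1 < q" unfolding q_def by (rule card_field_gt_1)
  then have "1 < q ^ 2" by (rule one_less_power) simp
  note S = card_fixed_points_power[OF this, where 'k = "'a alg_closure", folded S_def]
  have sq: "x ^ (q ^ 2) = (x ^ q) ^ q" for x :: "'a alg_closure"
    by (simp add: power2_eq_square power_mult)
  have bS: "b i \<in> S" for i
    using assms j
    by (simp add: S_def b_def proportional_def conj_form_def power_divide field_simps sq flip: q_def)
  have "(to_ac x :: 'a alg_closure) ^ q = to_ac x" for x :: 'a
    by (simp add: q_def power_card_eq_same flip: to_ac_power)
  then have im: "pairing b (to_ac \<circ> u) \<in> S" for u
    using bS by (simp add: S_def pairing_def sq card_power_sum[where 'a = 'a, folded q_def] power_mult_distrib)
  have "\<not> inj (\<lambda>u :: 3 \<Rightarrow> 'a. pairing b (to_ac \<circ> u))"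
  proof
    assume "inj (\<lambda>u :: 3 \<Rightarrow> 'a. pairing b (to_ac \<circ> u))"
    then have "card (UNIV :: (3 \<Rightarrow> 'a) set) \<le> card S"
      by (rule card_inj_on_le) (use im S(1) in auto)
    also have "\<dots> \<le> q ^ 2" by (rule S(2))
    also have "\<dots> < q ^ 3" using q by (intro power_strict_increasing) auto
    also have "\<dots> = card (UNIV :: (3 \<Rightarrow> 'a) set)" by (simp add: card_fun q_def)
    finally show False by simp
  qed
  then obtain u w :: "3 \<Rightarrow> 'a" where uw: "u \<noteq> w" "pairing b (to_ac \<circ> u) = pairing b (to_ac \<circ> w)"
    unfolding inj_def by blast
  have "pairing b (to_ac \<circ> (\<lambda>i. u i - w i)) = 0"
    using uw(2) by (simp add: pairing_def right_diff_distrib sum_subtractf)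
  then have "pairing a (to_ac \<circ> (\<lambda>i. u i - w i)) = 0"
    using j by (simp add: pairing_def b_def flip: sum_divide_distrib)
  moreover have "(\<lambda>i. u i - w i) \<noteq> (\<lambda>_. 0)"
    using uw(1) by (auto simp: fun_eq_iff)
  ultimately show ?thesis by blast
qed

section \<open>Four linear forms in three variables\<close>

definition det3 :: "(3 \<Rightarrow> 'k::comm_ring_1) \<Rightarrow> (3 \<Rightarrow> 'k) \<Rightarrow> (3 \<Rightarrow> 'k) \<Rightarrow> 'k" where
  "det3 a b c = a 0 * (b 1 * c 2 - b 2 * c 1) + a 1 * (b 2 * c 0 - b 0 * c 2)
     + a 2 * (b 0 * c 1 - b 1 * c 0)"

definition cross :: "(3 \<Rightarrow> 'k::comm_ring_1) \<Rightarrow> (3 \<Rightarrow> 'k) \<Rightarrow> 3 \<Rightarrow> 'k" where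
  "cross a b = triple (a 1 * b 2 - a 2 * b 1) (a 2 * b 0 - a 0 * b 2) (a 0 * b 1 - a 1 * b 0)"

lemma pairing_3: "pairing a v = a 0 * v 0 + a 1 * v 1 + a (2::3) * v 2"
  unfolding pairing_def UNIV_3_from_0 by (simp add: add.assoc)

lemma triple_simps [simp]: "triple x y z 0 = x" "triple x y z 1 = y" "triple x y z 2 = z"
  by (simp_all add: triple_def)

lemma pairing_cross: "pairing c (cross a b) = det3 a b c"
  by (simp add: pairing_3 cross_def det3_def algebra_simps)

lemma det3_repeat [simp]: "det3 a b a = 0" "det3 a b b = 0"
  by (simp_all add: det3_def algebra_simps)

lemma all_3_iff: "(\<forall>i::3. P i) \<longleftrightarrow> P 0 \<and> P 1 \<and> P 2"
  using UNIV_3_from_0 by (metis UNIV_I empty_iff insertE)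

lemma fun3_eq_iff: "f = g \<longleftrightarrow> f 0 = g 0 \<and> f 1 = g 1 \<and> f (2::3) = g 2"
  by (simp add: fun_eq_iff all_3_iff)

lemma cross_eq_zero_iff: "cross a b = (\<lambda>_. 0) \<longleftrightarrow> proportional a b"
  unfolding cross_def proportional_def fun3_eq_iff all_3_iff triple_simps right_minus_eq
  by metis

text \<open>The common zeros of two independent forms are the multiples of their cross product,
  because \<open>(a x b) x v = b (a . v) - a (b . v)\<close>.\<close>

lemma proportional_cross:
  fixes a b v w :: "3 \<Rightarrow> 'k::field"
  assumes "\<not> proportional a b" "pairing a v = 0" "pairing b v = 0" "pairing a w = 0" "pairing b w = 0"
  shows "proportional v w"
proof -
  have *: "proportional (cross a b) v" if "pairing a v = 0" "pairing b v = 0" for v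
  proof -
    have "cross (cross a b) v = (\<lambda>i. b i * pairing a v - a i * pairing b v)"
      by (simp add: pairing_3 cross_def fun3_eq_iff algebra_simps)
    then have "cross (cross a b) v = (\<lambda>_. 0)" using that by simp
    then show ?thesis by (simp add: cross_eq_zero_iff)
  qed
  have "cross a b \<noteq> (\<lambda>_. 0)" using assms(1) by (simp add: cross_eq_zero_iff)
  then show ?thesis
    using proportional_trans proportional_sym * assms(2-5) by metis
qed

text \<open>The coefficient of \<open>s\<^sup>2 t\<^sup>2\<close> in the product of the forms at \<open>s x - t y\<close>.\<close>

definition polar22 :: "'k::comm_ring_1 \<Rightarrow> 'k \<Rightarrow> 'k \<Rightarrow> 'k \<Rightarrow> 'k \<Rightarrow> 'k \<Rightarrow> 'k \<Rightarrow> 'k \<Rightarrow> 'k" where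
  "polar22 p0 p1 p2 p3 r0 r1 r2 r3 =
     p0 * p1 * r2 * r3 + p0 * p2 * r1 * r3 + p0 * p3 * r1 * r2
     + p1 * p2 * r0 * r3 + p1 * p3 * r0 * r2 + p2 * p3 * r0 * r1"

text \<open>The functions \<open>A\<close>, \<open>B\<close>, \<open>C\<close>, \<open>E\<close> are
  arbitrary, so coefficients cannot be compared directly. Subtracting the affine interpolation in
  \<open>t\<close> at 0 and 1 kills \<open>t * B s + C s\<close> and leaves something affine in
  \<open>s\<close>. Applied to the expanded product, the same operation leaves
  \<open>(t ^ 2 - t) * e\<close> as the coefficient of \<open>s ^ 2\<close>.\<close>

lemma polar22_eq_0:
  fixes p0 p1 p2 p3 r0 r1 r2 r3 :: "'k::field"
  assumes inf: "infinite (UNIV :: 'k set)"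
    and H: "\<And>s t. (s * p0 - t * r0) * (s * p1 - t * r1) * (s * p2 - t * r2) * (s * p3 - t * r3)
      = s * A t + t * B s + C s + E t"
  shows "polar22 p0 p1 p2 p3 r0 r1 r2 r3 = 0"
proof -
  obtain t :: 'k where t: "t \<notin> {0, 1}" using inf ex_new_if_finite[of "{0, 1}"] by blast
  define e f g h l where e: "e = polar22 p0 p1 p2 p3 r0 r1 r2 r3"
    and f: "f = p0 * r1 * r2 * r3 + p1 * r0 * r2 * r3 + p2 * r0 * r1 * r3 + p3 * r0 * r1 * r2"
    and g: "g = r0 * r1 * r2 * r3"
    and h: "h = r0 * p1 * p2 * p3 + r1 * p0 * p2 * p3 + r2 * p0 * p1 * p3 + r3 * p0 * p1 * p2"
    and l: "l = p0 * p1 * p2 * p3"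
  define P where "P s t = (s * p0 - t * r0) * (s * p1 - t * r1) * (s * p2 - t * r2) * (s * p3 - t * r3)"
    for s t
  have expand: "P s t = s ^ 4 * l - s ^ 3 * t * h + s ^ 2 * t ^ 2 * e - s * t ^ 3 * f + t ^ 4 * g"
    for s t
    unfolding P_def e f g h l polar22_def
    by (simp add: left_diff_distrib right_diff_distrib distrib_left distrib_right mult_ac
        power2_eq_square power3_eq_cube power4_eq_xxxx)
  define \<alpha> \<beta> where \<alpha>: "\<alpha> = A t - t * A 1 - (1 - t) * A 0"
    and \<beta>: "\<beta> = E t - t * E 1 - (1 - t) * E 0"
  define c1 c0 where "c1 = - (t ^ 3 - t) * f - \<alpha>" and "c0 = (t ^ 4 - t) * g - \<beta>"
  have *: "(t ^ 2 - t) * e * s ^ 2 + c1 * s + c0 = 0" for s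
  proof -
    have "P s t - t * P s 1 - (1 - t) * P s 0
        = (t ^ 2 - t) * e * s ^ 2 - (t ^ 3 - t) * f * s + (t ^ 4 - t) * g"
      unfolding expand by (simp add: algebra_simps)
    moreover have "P s t - t * P s 1 - (1 - t) * P s 0
        = s * \<alpha> + \<beta>"
      unfolding P_def H \<alpha> \<beta> by (simp add: algebra_simps)
    ultimately have "(t ^ 2 - t) * e * s ^ 2 - (t ^ 3 - t) * f * s + (t ^ 4 - t) * g = s * \<alpha> + \<beta>"
      by simp
    moreover have "(t ^ 2 - t) * e * s ^ 2 + c1 * s + c0
        = ((t ^ 2 - t) * e * s ^ 2 - (t ^ 3 - t) * f * s + (t ^ 4 - t) * g) - (s * \<alpha> + \<beta>)"
      unfolding c1_def c0_def by (simp add: algebra_simps)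
    ultimately show ?thesis by simp
  qed
  \<comment> \<open>A quadratic in \<open>s\<close> that vanishes at the three distinct points 0, 1
    and \<open>t\<close> has leading coefficient zero.\<close>
  have "(t ^ 2 - t) * ((t ^ 2 - t) * e) = 0"
  proof -
    have c0: "c0 = 0" using *[of 0] by simp
    have c1: "c1 = - ((t ^ 2 - t) * e)" using *[of 1] c0 by (simp add: eq_neg_iff_add_eq_0 add.commute)
    show ?thesis using *[of t] unfolding c0 c1 by (simp add: algebra_simps power2_eq_square)
  qed
  moreover have "t ^ 2 - t \<noteq> 0" using t by (simp add: power2_eq_square)
  ultimately show ?thesis by (simp add: e)
qed

text \<open>At \<open>y = cross a b\<close> the forms \<open>a\<close> and \<open>b\<close> vanish,
  so a single term of \<open>polar22\<close> survives. Choosing \<open>x\<close> off the kernels of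
  \<open>a\<close> and \<open>b\<close> yields \<open>det3 a b c * det3 a b d = 0\<close>, and
  likewise for the other two pairs among \<open>a\<close>, \<open>b\<close>, \<open>c\<close>. If
  \<open>det3 a b c\<close> were nonzero, Cramer's rule would then force
  \<open>d = 0\<close>.\<close>

lemma det3_eq_0_if_polar22:
  fixes a b c d :: "3 \<Rightarrow> 'k::field"
  assumes inf: "infinite (UNIV :: 'k set)"
    and nz: "a \<noteq> (\<lambda>_. 0)" "b \<noteq> (\<lambda>_. 0)" "c \<noteq> (\<lambda>_. 0)" "d \<noteq> (\<lambda>_. 0)"
    and H: "\<And>x y. polar22 (pairing a x) (pairing b x) (pairing c x) (pairing d x)
      (pairing a y) (pairing b y) (pairing c y) (pairing d y) = 0"
  shows "det3 a b c = 0"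
proof (rule ccontr)
  assume D: "det3 a b c \<noteq> 0"
  have ex: "\<exists>x. pairing e x \<noteq> 0 \<and> pairing f x \<noteq> 0"
    if "e \<noteq> (\<lambda>_. 0)" "f \<noteq> (\<lambda>_. 0)" for e f :: "3 \<Rightarrow> 'k"
  proof -
    have "\<exists>x. pairing g x \<noteq> 0" if g: "g \<noteq> (\<lambda>_. 0)" for g :: "3 \<Rightarrow> 'k"
    proof -
      obtain i where "g i \<noteq> 0" using g by auto
      then have "pairing g (\<lambda>j. if j = i then 1 else 0) \<noteq> 0" by (simp add: pairing_indicator)
      then show ?thesis by blast
    qed
    then show ?thesis
      using linear_space_not_union_of_kernels[OF inf, of "{e, f}" UNIV "\<lambda>g. g"] that by auto
  qed
  obtain x where x: "pairing a x \<noteq> 0" "pairing b x \<noteq> 0" using ex nz by blast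
  have "det3 a b c * det3 a b d = 0"
    using H[of x "cross a b"] x unfolding polar22_def pairing_cross
    by simp
  then have abd: "det3 a b d = 0" using D by simp
  obtain x where x: "pairing a x \<noteq> 0" "pairing c x \<noteq> 0" using ex nz by blast
  have "det3 a c b * det3 a c d = 0"
    using H[of x "cross a c"] x unfolding polar22_def pairing_cross
    by simp
  moreover have "det3 a c b = - det3 a b c" by (simp add: det3_def algebra_simps)
  ultimately have acd: "det3 a c d = 0" using D by simp
  obtain x where x: "pairing b x \<noteq> 0" "pairing c x \<noteq> 0" using ex nz by blast
  have "det3 b c a * det3 b c d = 0"
    using H[of x "cross b c"] x unfolding polar22_def pairing_cross
    by simp
  moreover have "det3 b c a = det3 a b c" by (simp add: det3_def algebra_simps)
  ultimately have bcd: "det3 b c d = 0" using D by simp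
  have cramer: "det3 a b c * d i = det3 b c d * a i - det3 a c d * b i + det3 a b d * c i" for i
  proof -
    have "i \<in> {0, 1, 2}" using UNIV_3_from_0 by blast
    then show ?thesis by (elim insertE) (simp_all add: det3_def algebra_simps)
  qed
  then have "d = (\<lambda>_. 0)" using abd acd bcd D by auto
  then show False using nz by simp
qed

section \<open>Forms in seven variables and the diagonal\<close>

lemma pairing_7:
  "pairing a v = a 0 * v 0 + a 1 * v 1 + a 2 * v 2 + a 3 * v 3 + a 4 * v 4 + a 5 * v 5
     + a (6::7) * v 6"
  unfolding pairing_def UNIV_7 by (simp add: add.assoc)

lemma fun7_eq_iff:
  "f = g \<longleftrightarrow> f 0 = g 0 \<and> f 1 = g 1 \<and> f 2 = g 2 \<and> f 3 = g 3 \<and> f 4 = g 4 \<and> f 5 = g 5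
     \<and> f (6::7) = g 6"
proof -
  have "(\<forall>i::7. P i) \<longleftrightarrow> (\<forall>i\<in>{0, 1, 2, 3, 4, 5, 6}. P i)" for P
    by (simp flip: UNIV_7)
  then show ?thesis by (simp add: fun_eq_iff)
qed

text \<open>The forms that vanish on the diagonal \<open>X\<^sub>1 = X\<^sub>4, X\<^sub>2 = X\<^sub>5, X\<^sub>3 = X\<^sub>6\<close>.\<close>

definition diagonal_form :: "(7 \<Rightarrow> 'k::comm_ring_1) \<Rightarrow> bool" where
  "diagonal_form a \<longleftrightarrow> a 0 = 0 \<and> a 4 = - a 1 \<and> a 5 = - a 2 \<and> a 6 = - a 3"

lemma diagonal_formI:
  fixes a :: "7 \<Rightarrow> 'k::comm_ring_1"
  assumes "\<And>v. v 1 = v 4 \<Longrightarrow> v 2 = v 5 \<Longrightarrow> v 3 = v 6 \<Longrightarrow> pairing a v = 0"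
  shows "diagonal_form a"
  unfolding diagonal_form_def
  using assms[of "\<lambda>i. if i = 0 then 1 else 0"] assms[of "\<lambda>i. if i = 1 \<or> i = 4 then 1 else 0"]
    assms[of "\<lambda>i. if i = 2 \<or> i = 5 then 1 else 0"] assms[of "\<lambda>i. if i = 3 \<or> i = 6 then 1 else 0"]
  by (simp add: pairing_7 eq_neg_iff_add_eq_0 add.commute)

lemma diagonal_form_proportional:
  fixes a b :: "7 \<Rightarrow> 'k::field"
  assumes "proportional a b" "a \<noteq> (\<lambda>_. 0)" "diagonal_form a"
  shows "diagonal_form b"
proof -
  obtain c where "b = (\<lambda>i. c * a i)" using proportional_scale[OF assms(1,2)] by blast
  then show ?thesis using assms(3) by (simp add: diagonal_form_def)
qed

lemma diagonal_form_conj: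
  fixes a :: "7 \<Rightarrow> 'a::{field,finite} alg_closure"
  shows "diagonal_form (conj_form a) \<longleftrightarrow> diagonal_form a"
proof -
  \<comment> \<open>Deriving this from additivity avoids a case distinction on the parity of
    q.\<close>
  have *: "- (x ^ CARD('a)) = (- x) ^ CARD('a)" for x :: "'a alg_closure"
    using card_power_add[of x "- x"] by (simp add: neg_eq_iff_add_eq_0 zero_power)
  show ?thesis
    by (simp add: diagonal_form_def conj_form_def * card_power_eq_iff)
qed

text \<open>A diagonal form is determined by these coefficients: its value at \<open>v\<close> is
  their pairing with \<open>(v 1 - v 4, v 2 - v 5, v 3 - v 6)\<close>.\<close>

definition first_block :: "(7 \<Rightarrow> 'k) \<Rightarrow> 3 \<Rightarrow> 'k" where
  "first_block a i = a (triple 1 2 3 i)"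

lemma first_block_simps [simp]:
  "first_block a 0 = a 1" "first_block a 1 = a 2" "first_block a 2 = a 3"
  by (simp_all add: first_block_def)

lemma first_block_conj: "first_block (conj_form a) = conj_form (first_block a)"
  by (simp add: first_block_def conj_form_def fun_eq_iff)

lemma first_block_proportional: "proportional a b \<Longrightarrow> proportional (first_block a) (first_block b)"
  by (simp add: proportional_def first_block_def)

lemma first_block_eq_zero:
  assumes "diagonal_form a" "first_block a = (\<lambda>_. 0)"
  shows "a = (\<lambda>_. 0)"
  using assms by (simp add: fun3_eq_iff fun7_eq_iff diagonal_form_def)

section \<open>Rational zeros of a quartic that splits into linear factors\<close>

text \<open>Here \<open>\<Phi>\<close> stands for F as a function on the closure and the
  \<open>A i\<close> for the coefficient vectors of its factors. Of the three cubics only functions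
  \<open>g1\<close>, \<open>g2\<close>, \<open>g3\<close> remain; \<open>not_infinity\<close> says
  that no factor is a multiple of \<open>X_0\<close>.\<close>

locale split_quartic =
  fixes A :: "nat \<Rightarrow> 7 \<Rightarrow> 'a::{field,finite} alg_closure"
    and \<Phi> :: "(7 \<Rightarrow> 'a alg_closure) \<Rightarrow> 'a alg_closure"
    and g1 g2 g3 :: "'a alg_closure \<Rightarrow> 'a alg_closure \<Rightarrow> 'a alg_closure \<Rightarrow> 'a alg_closure"
  assumes product: "\<And>v. \<Phi> v = (\<Prod>i<4. pairing (A i) v)"
    and frobenius: "\<And>v. \<Phi> (conj_form v) = \<Phi> v ^ CARD('a)"
    and shape: "\<And>v. v 0 = 1 \<Longrightarrow> \<Phi> v =
        (v 1 - v 4) * (g3 (v 4) (v 5) (v 6) - g3 (v 1) (v 2) (v 3))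
      + (v 2 - v 5) * (g2 (v 4) (v 5) (v 6) - g2 (v 1) (v 2) (v 3))
      + (v 3 - v 6) * (g1 (v 4) (v 5) (v 6) - g1 (v 1) (v 2) (v 3))"
    and not_infinity: "\<And>i. i < 4 \<Longrightarrow> \<exists>j. j \<noteq> 0 \<and> A i j \<noteq> 0"
begin

lemma nonzero: "i < 4 \<Longrightarrow> A i \<noteq> (\<lambda>_. 0)"
  using not_infinity by fastforce

lemma infinite_K: "infinite (UNIV :: 'a alg_closure set)"
  by (rule infinite_alg_closed)

text \<open>Otherwise some point of the diagonal space lies off all four kernels and has
  \<open>X_0\<close> nonzero. Scaled to \<open>X_0 = 1\<close> it contradicts \<open>shape\<close>,
  which gives the value 0 there.\<close>

lemma ex_diagonal: "\<exists>i<4. diagonal_form (A i)"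
proof (rule ccontr)
  assume no: "\<not> ?thesis"
  define V :: "(7 \<Rightarrow> 'a alg_closure) set" where "V = {v. v 1 = v 4 \<and> v 2 = v 5 \<and> v 3 = v 6}"
  \<comment> \<open>The coordinate \<open>X_0\<close> is added as a fifth form, at index 4, so that
    the point found can be made affine.\<close>
  define e :: "7 \<Rightarrow> 'a alg_closure" where "e = (\<lambda>j. if j = 0 then 1 else 0)"
  have e: "pairing e v = v 0" for v by (simp add: pairing_7 e_def)
  have "\<exists>v\<in>V. \<forall>i\<in>{..<5}. pairing ((A(4 := e)) i) v \<noteq> 0"
  proof (rule linear_space_not_union_of_kernels[OF infinite_K])
    fix i :: nat assume "i \<in> {..<5}"
    then consider "i = 4" | "i < 4" by fastforce
    then show "\<exists>v\<in>V. pairing ((A(4 := e)) i) v \<noteq> 0"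
    proof cases
      case 1
      then show ?thesis by (auto simp: e V_def intro!: exI[of _ "\<lambda>_. 1"])
    next
      case 2
      then have "\<not> diagonal_form (A i)" using no by blast
      then show ?thesis using diagonal_formI[of "A i"] 2 unfolding V_def by fastforce
    qed
  qed (auto simp: V_def)
  then obtain v where v: "v \<in> V" "\<forall>i\<in>{..<5}. pairing ((A(4 := e)) i) v \<noteq> 0" by blast
  have v0: "v 0 \<noteq> 0" using v(2)[rule_format, of 4] by (simp add: e)
  define w where "w i = v i / v 0" for i
  have "pairing (A i) w \<noteq> 0" if "i < 4" for i
  proof -
    have "pairing (A i) w = pairing (A i) v / v 0"
      by (simp add: pairing_def w_def sum_divide_distrib)
    then show ?thesis using v(2)[rule_format, of i] that v0 by simp
  qed
  then have "\<Phi> w \<noteq> 0" by (simp add: product)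
  moreover have "\<Phi> w = 0"
    using v(1) v0 by (subst shape) (simp_all add: w_def V_def)
  ultimately show False by simp
qed

text \<open>The zero set of \<open>\<Phi>\<close> is stable under Frobenius, so it contains the
  hyperplane conjugate to that of \<open>A i\<close>. If this differed from the kernels of all four
  factors, some point of it would avoid them all.\<close>

lemma conj_proportional:
  assumes "i < 4"
  shows "\<exists>j<4. proportional (conj_form (A i)) (A j)"
proof (rule ccontr)
  assume no: "\<not> ?thesis"
  define V where "V = {v. pairing (conj_form (A i)) v = 0}"
  have "\<exists>v\<in>V. \<forall>j\<in>{..<4}. pairing (A j) v \<noteq> 0"
  proof (rule linear_space_not_union_of_kernels[OF infinite_K])
    fix j :: nat assume "j \<in> {..<4}"
    then have "\<not> proportional (conj_form (A i)) (A j)" using no by blast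
    then show "\<exists>v\<in>V. pairing (A j) v \<noteq> 0"
      using proportional_if_kernel_subset unfolding V_def by blast
  next
    have "(\<lambda>_. 0) \<in> V" by (simp add: V_def pairing_def)
    then show "V \<noteq> {}" by blast
  qed (auto simp: V_def pairing_add_scale)
  then obtain v where v: "v \<in> V" "\<Phi> v \<noteq> 0" by (auto simp: product)
  obtain w where w: "v = conj_form w" using conj_form_surj by blast
  have "pairing (A i) w = 0" using v(1) by (simp add: V_def w pairing_conj)
  then have "\<Phi> w = 0" using assms by (auto simp: product)
  then show False using v(2) by (simp add: w frobenius)
qed

lemma conj_proportional_diagonal:
  assumes "i < 4"
  shows "\<exists>j<4. proportional (conj_form (A i)) (A j) \<and> (diagonal_form (A j) \<longleftrightarrow> diagonal_form (A i))"
proof -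
  obtain j where j: "j < 4" "proportional (conj_form (A i)) (A j)"
    using conj_proportional[OF assms] by blast
  have "conj_form (A i) \<noteq> (\<lambda>_. 0)" using nonzero[OF assms] by (simp add: conj_form_eq_zero_iff)
  then have "diagonal_form (A j) \<longleftrightarrow> diagonal_form (conj_form (A i))"
    using j diagonal_form_proportional nonzero proportional_sym by metis
  then show ?thesis using j by (auto simp: diagonal_form_conj)
qed

text \<open>For the F of the theorem, such a zero yields two distinct orthogonal points of
  \<open>O7\<close>. The lemmas that follow treat the possible numbers of diagonal factors.\<close>

abbreviation rational_point :: bool where
  "rational_point \<equiv>
     \<exists>v :: 7 \<Rightarrow> 'a. v 0 = 1 \<and> (v 1, v 2, v 3) \<noteq> (v 4, v 5, v 6) \<and> \<Phi> (to_ac \<circ> v) = 0"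

lemma rational_point_diagonal:
  fixes u :: "3 \<Rightarrow> 'a"
  assumes "i < 4" "diagonal_form (A i)" "u \<noteq> (\<lambda>_. 0)" "pairing (first_block (A i)) (to_ac \<circ> u) = 0"
  shows rational_point
proof -
  \<comment> \<open>With the second block zero, the difference of the two blocks is
    \<open>u\<close>.\<close>
  define v where "v = (\<lambda>j::7. if j = 0 then 1 else if j = 1 then u 0 else if j = 2 then u 1
    else if j = 3 then u 2 else 0)"
  have "pairing (A i) (to_ac \<circ> v) = 0"
    using assms by (simp add: pairing_7 pairing_3 v_def diagonal_form_def)
  then have "\<Phi> (to_ac \<circ> v) = 0" using assms(1) by (auto simp: product)
  moreover have "(v 1, v 2, v 3) \<noteq> (v 4, v 5, v 6)"
    using assms(3) by (auto simp: v_def fun3_eq_iff)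
  ultimately show ?thesis by (intro exI[of _ v]) (simp add: v_def)
qed

lemma rational_point_quadratic:
  assumes "i < 4" "diagonal_form (A i)"
    "proportional (first_block (A i)) (conj_form (conj_form (first_block (A i))))"
  shows rational_point
  using quadratic_form_rational_zero[OF assms(3)] rational_point_diagonal[OF assms(1,2)] by blast

lemma rational_point_single_nondiagonal:
  assumes "{i. i < 4 \<and> \<not> diagonal_form (A i)} = {i}"
  shows rational_point
proof -
  have i: "i < 4" "\<not> diagonal_form (A i)" using assms by auto
  obtain j where j: "j < 4" "proportional (conj_form (A i)) (A j)" "\<not> diagonal_form (A j)"
    using conj_proportional_diagonal[OF i(1)] i(2) by blast
  then have "j = i" using assms by auto
  then have "proportional (A i) (conj_form (A i))" using j(2) by (simp add: proportional_sym)
  then obtain c b where c: "c \<noteq> 0" and b: "A i = (\<lambda>j. c * to_ac (b j))"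
    using proportional_conj_imp_rational nonzero[OF i(1)] by blast
  obtain j where j: "j \<noteq> 0" "b j \<noteq> 0" using not_infinity[OF i(1)] b by auto
  \<comment> \<open>The index \<open>k\<close> lies outside that pair among {1, 4}, {2, 5}, {3, 6}
    which contains \<open>j\<close>. So \<open>v k = 1\<close> while its partner entry stays 0,
    which puts \<open>v\<close> off the diagonal; the entry at \<open>j\<close> is solved from
    \<open>pairing b v = 0\<close>.\<close>
  define k :: 7 where "k = (if j = 1 \<or> j = 4 then 5 else 4)"
  have jk: "j \<noteq> k" "k \<noteq> 0" by (auto simp: k_def)
  define v where "v = (\<lambda>l. (if l = 0 then 1 else 0) + 1 * ((if l = k then 1 else 0)
    + - ((b 0 + b k) / b j) * (if l = j then 1 else 0)))"
  have "pairing b v = 0"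
    unfolding v_def pairing_add_scale pairing_indicator using j by (simp add: field_simps)
  then have "pairing (A i) (to_ac \<circ> v) = 0"
    by (simp add: b pairing_def mult.assoc flip: sum_distrib_left to_ac_mult to_ac_sum)
  then have "\<Phi> (to_ac \<circ> v) = 0" using i(1) by (auto simp: product)
  moreover have "(v 1, v 2, v 3) \<noteq> (v 4, v 5, v 6)"
    using jk by (auto simp: v_def k_def split: if_splits)
  ultimately show ?thesis using j jk by (intro exI[of _ v]) (simp add: v_def)
qed

text \<open>Conjugating a diagonal factor twice leads from \<open>i\<close> to \<open>j\<close> to
  \<open>l\<close>, all diagonal. With at most two such indices there must be a repetition, and each
  possible one makes \<open>A i\<close> proportional to its second conjugate.\<close>

lemma rational_point_few_diagonal:
  assumes "card {i. i < 4 \<and> diagonal_form (A i)} \<le> 2"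
  shows rational_point
proof -
  let ?D = "{i. i < 4 \<and> diagonal_form (A i)}"
  let ?c = conj_form
  obtain i where i: "i < 4" "diagonal_form (A i)" using ex_diagonal by blast
  obtain j where j: "j < 4" "diagonal_form (A j)" "proportional (?c (A i)) (A j)"
    using conj_proportional_diagonal[OF i(1)] i(2) by blast
  obtain l where l: "l < 4" "diagonal_form (A l)" "proportional (?c (A j)) (A l)"
    using conj_proportional_diagonal[OF j(1)] j(2) by blast
  have nz: "A i \<noteq> (\<lambda>_. 0)" "A j \<noteq> (\<lambda>_. 0)" "?c (A i) \<noteq> (\<lambda>_. 0)" "?c (A j) \<noteq> (\<lambda>_. 0)"
    using nonzero i j by (simp_all add: conj_form_eq_zero_iff)
  have fixed: "proportional (?c (?c (A i))) (A i)" if "proportional (?c (A i)) (A i)"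
    using that proportional_conj_iff[of "?c (A i)" "A i"] nz proportional_trans by blast
  have cc: "proportional (?c (?c (A i))) (?c (A j))" using j by (simp add: proportional_conj_iff)
  have "proportional (?c (?c (A i))) (A i)"
  proof (cases "j = i")
    case True
    then show ?thesis using fixed j by simp
  next
    case False
    have "{i, j} = ?D" by (rule card_seteq) (use i j assms False in auto)
    then consider "l = i" | "l = j" using l by blast
    then show ?thesis
    proof cases
      case 1
      then show ?thesis using proportional_trans[OF cc] l nz by simp
    next
      \<comment> \<open>Both \<open>A j\<close> and the conjugate of \<open>A i\<close> are now
        proportional to the conjugate of \<open>A j\<close>. Undoing the conjugation makes
        \<open>A i\<close> and \<open>A j\<close> proportional, so \<open>A i\<close> is fixed up to
        a scalar.\<close>
      case 2
      then have "proportional (?c (A j)) (?c (A i))"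
        using l j nz proportional_trans proportional_sym by metis
      then have "proportional (A j) (A i)" by (simp add: proportional_conj_iff)
      then show ?thesis using proportional_trans[OF j(3)] nz fixed by simp
    qed
  qed
  then have "proportional (first_block (A i)) (?c (?c (first_block (A i))))"
    using first_block_proportional proportional_sym first_block_conj by metis
  then show ?thesis using rational_point_quadratic i by blast
qed

lemma rational_point_all_diagonal:
  assumes D: "\<And>i. i < 4 \<Longrightarrow> diagonal_form (A i)"
  shows rational_point
proof -
  define B where "B i = first_block (A i)" for i
  let ?c = conj_form
  have nz: "B i \<noteq> (\<lambda>_. 0)" if "i < 4" for i
    unfolding B_def using first_block_eq_zero D nonzero that by blast
  have conj: "\<exists>j<4. proportional (?c (B i)) (B j)" if "i < 4" for i
    using conj_proportional[OF that] first_block_proportional unfolding B_def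
    by (metis first_block_conj)
  have four: "(\<Prod>i<4. f i) = f 0 * f 1 * f 2 * f 3" for f :: "nat \<Rightarrow> 'a alg_closure"
    by (simp add: numeral_eq_Suc lessThan_Suc mult_ac)
  \<comment> \<open>At the point \<open>(1, s x, t y)\<close> the factors become
    \<open>s p - t r\<close>, and \<open>shape\<close> splits the product into terms that are linear
    in \<open>s\<close> or in \<open>t\<close> or depend on one of them only.\<close>
  have polar: "polar22 (pairing (B 0) x) (pairing (B 1) x) (pairing (B 2) x) (pairing (B 3) x)
      (pairing (B 0) y) (pairing (B 1) y) (pairing (B 2) y) (pairing (B 3) y) = 0" for x y
  proof (rule polar22_eq_0[OF infinite_K])
    let ?g = "\<lambda>g t z. g (t * z 0) (t * z 1) (t * z (2::3))"
    let ?G = "\<lambda>z t w. z 0 * ?g g3 t w + z 1 * ?g g2 t w + z (2::3) * ?g g1 t w"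
    fix s t
    define v where "v = (\<lambda>j::7. if j = 0 then 1 else if j = 1 then s * x 0 else if j = 2 then s * x 1
      else if j = 3 then s * x 2 else if j = 4 then t * y 0 else if j = 5 then t * y 1 else t * y 2)"
    have "pairing (A i) v = s * pairing (B i) x - t * pairing (B i) y" if "i < 4" for i
      using D[OF that] by (simp add: diagonal_form_def pairing_7 pairing_3 v_def B_def algebra_simps)
    then have "(s * pairing (B 0) x - t * pairing (B 0) y) * (s * pairing (B 1) x - t * pairing (B 1) y)
      * (s * pairing (B 2) x - t * pairing (B 2) y) * (s * pairing (B 3) x - t * pairing (B 3) y) = \<Phi> v"
      by (simp add: product four)
    also have "\<dots> = s * ?G x t y + t * ?G y s x + - (s * ?G x s x) + - (t * ?G y t y)"
      by (subst shape) (simp_all add: v_def algebra_simps)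
    finally show "(s * pairing (B 0) x - t * pairing (B 0) y) * (s * pairing (B 1) x - t * pairing (B 1) y)
      * (s * pairing (B 2) x - t * pairing (B 2) y) * (s * pairing (B 3) x - t * pairing (B 3) y)
      = s * ?G x t y + t * ?G y s x + - (s * ?G x s x) + - (t * ?G y t y)" .
  qed
  \<comment> \<open>Since \<open>polar22\<close> is symmetric in the four forms, each can play the
    role of the omitted one; the triples containing \<open>B 0\<close> suffice for what
    follows.\<close>
  have det: "det3 (B 0) (B 1) (B 2) = 0" "det3 (B 0) (B 1) (B 3) = 0" "det3 (B 0) (B 2) (B 3) = 0"
  proof -
    show "det3 (B 0) (B 1) (B 2) = 0"
      by (rule det3_eq_0_if_polar22[OF infinite_K, where d = "B 3"]) (use nz polar in auto)
    show "det3 (B 0) (B 1) (B 3) = 0"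
      by (rule det3_eq_0_if_polar22[OF infinite_K, where d = "B 2"])
        (use nz polar in \<open>auto simp: polar22_def ac_simps\<close>)
    show "det3 (B 0) (B 2) (B 3) = 0"
      by (rule det3_eq_0_if_polar22[OF infinite_K, where d = "B 1"])
        (use nz polar in \<open>auto simp: polar22_def ac_simps\<close>)
  qed
  have swap: "det3 a c b = - det3 a b c" for a b c :: "3 \<Rightarrow> 'a alg_closure"
    by (simp add: det3_def algebra_simps)
  have dets: "det3 (B 0) (B j) (B k) = 0" if "j < 4" "k < 4" for j k
  proof -
    have "j \<in> {0, 1, 2, 3}" "k \<in> {0, 1, 2, 3}" using that by auto
    then show ?thesis
      using det swap[of "B 0" "B 1" "B 2"] swap[of "B 0" "B 1" "B 3"] swap[of "B 0" "B 2" "B 3"]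
        swap[of "B 0" "B 0"]
      by auto
  qed
  show ?thesis
  proof (cases "\<forall>j<4. proportional (B 0) (B j)")
    case True
    \<comment> \<open>All factors are multiples of \<open>B 0\<close>, so Frobenius fixes it up to a
      scalar.\<close>
    obtain j where "j < 4" "proportional (?c (B 0)) (B j)" using conj[of 0] by auto
    then have *: "proportional (?c (B 0)) (B 0)" using True nz proportional_trans proportional_sym by metis
    then have "proportional (?c (?c (B 0))) (?c (B 0))" by (simp add: proportional_conj_iff)
    then have "proportional (B 0) (?c (?c (B 0)))"
      using * nz[of 0] proportional_trans proportional_sym conj_form_eq_zero_iff by (metis zero_less_numeral)
    then show ?thesis using rational_point_quadratic[of 0] D by (simp add: B_def)
  next
    case False
    then obtain j where j: "j < 4" "\<not> proportional (B 0) (B j)" by blast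
    \<comment> \<open>The forms all lie in the span of \<open>B 0\<close> and \<open>B j\<close>, so
      \<open>w\<close> is their common zero, unique up to a scalar. Frobenius preserves the set of
      forms up to scalars; hence \<open>w\<close> is proportional to its conjugate and thus to a
      rational point.\<close>
    define w where "w = cross (B 0) (B j)"
    have w0: "w \<noteq> (\<lambda>_. 0)" using j by (simp add: w_def cross_eq_zero_iff)
    have w: "pairing (B k) w = 0" if "k < 4" for k
      using dets[OF j(1) that] by (simp add: w_def pairing_cross)
    have c: "pairing (?c (B k)) w = 0" if "k < 4" for k
      using conj[OF that] w pairing_proportional nz proportional_sym by metis
    have "pairing (?c (B k)) (?c w) = 0" if "k < 4" for k
      using w[OF that] by (simp add: pairing_conj)
    then have "proportional w (?c w)"
      using proportional_cross[of "?c (B 0)" "?c (B j)" w "?c w"] j c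
      by (simp add: proportional_conj_iff)
    then obtain s b where sb: "s \<noteq> 0" "w = (\<lambda>i. s * to_ac (b i))"
      using proportional_conj_imp_rational w0 by blast
    have "pairing (B 0) w = s * pairing (B 0) (to_ac \<circ> b)"
      by (simp add: sb pairing_def sum_distrib_left mult_ac)
    then have "pairing (B 0) (to_ac \<circ> b) = 0" using w[of 0] sb by simp
    moreover have "b \<noteq> (\<lambda>_. 0)" using w0 sb by auto
    ultimately show ?thesis using rational_point_diagonal[of 0 b] D by (simp add: B_def)
  qed
qed

lemma rational_point: rational_point
proof -
  let ?D = "{i. i < 4 \<and> diagonal_form (A i)}" and ?N = "{i. i < 4 \<and> \<not> diagonal_form (A i)}"
  have "?D \<union> ?N = {..<4}" by auto
  then have "card ?D + card ?N = 4"
    by (subst card_Un_disjoint[symmetric]) auto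
  then consider "card ?N = 0" | "card ?N = 1" | "card ?D \<le> 2" by linarith
  then show ?thesis
  proof cases
    case 1
    then show ?thesis using rational_point_all_diagonal by auto
  next
    case 2
    then show ?thesis using rational_point_single_nondiagonal by (auto simp: card_1_singleton_iff)
  qed (rule rational_point_few_diagonal)
qed

end

section \<open>Homogenization\<close>

definition var_free :: "'v \<Rightarrow> ('v, 'a::comm_ring_1) mpoly \<Rightarrow> bool" where
  "var_free v0 p \<longleftrightarrow> (\<forall>m\<in>Poly_Mapping.keys p. Poly_Mapping.lookup m v0 = 0)"

lemma var_free_mult: "var_free v0 p \<Longrightarrow> var_free v0 r \<Longrightarrow> var_free v0 (p * r)"
  using keys_mult[of p r] by (force simp: var_free_def lookup_add)

lemma var_free_add: "var_free v0 p \<Longrightarrow> var_free v0 r \<Longrightarrow> var_free v0 (p + r)"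
  using Poly_Mapping.keys_add[of p r] by (auto simp: var_free_def)

lemma var_free_diff: "var_free v0 p \<Longrightarrow> var_free v0 r \<Longrightarrow> var_free v0 (p - r)"
  using keys_diff[of p r] by (auto simp: var_free_def)

lemma var_free_const: "var_free v0 (mp_const c)"
  by (simp add: var_free_def mp_const_def)

lemma var_free_var: "v \<noteq> v0 \<Longrightarrow> var_free v0 (mp_var v)"
  by (simp add: var_free_def mp_var_def lookup_single)

lemma var_free_prod: "(\<And>i. i \<in> I \<Longrightarrow> var_free v0 (g i)) \<Longrightarrow> var_free v0 (\<Prod>i\<in>I. g i)"
proof (induction I rule: infinite_finite_induct)
  case (insert i I)
  then show ?case by (simp add: var_free_mult)
qed (simp_all add: var_free_def)

lemma var_free_power: "var_free v0 p \<Longrightarrow> var_free v0 (p ^ n)"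
  using var_free_prod[of "{..<n}" v0 "\<lambda>_. p"] by simp

lemma var_free_sum: "(\<And>i. i \<in> I \<Longrightarrow> var_free v0 (g i)) \<Longrightarrow> var_free v0 (\<Sum>i\<in>I. g i)"
  by (induction I rule: infinite_finite_induct) (simp_all add: var_free_add, simp_all add: var_free_def)

lemma var_free_subst: "(\<And>v. var_free v0 (\<sigma> v)) \<Longrightarrow> var_free v0 (mp_subst \<sigma> p)"
  unfolding mp_subst_def mp_hom_def
  by (intro var_free_sum var_free_mult var_free_prod var_free_power var_free_const)

lemma var_free_S_affine: "var_free 0 (S_affine f1 f2 f3)"
  unfolding S_affine_def S_diff_def
  by (intro var_free_add var_free_mult var_free_diff var_free_subst)
    (auto simp: triple_def intro!: var_free_var)

text \<open>A monomial of top degree receives no power of \<open>v0\<close>. Its coefficient cannot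
  cancel, since a contribution from any other monomial with the same image would carry a positive
  power of \<open>v0\<close>.\<close>

lemma homogenize_has_key_without_var:
  assumes "p \<noteq> 0" "var_free v0 p"
  shows "\<exists>m\<in>Poly_Mapping.keys (mp_homogenize v0 p). Poly_Mapping.lookup m v0 = 0"
proof -
  have "\<exists>m\<in>Poly_Mapping.keys p. mon_degree m = mp_degree p"
  proof -
    obtain n where n: "n \<in> Poly_Mapping.keys p" using assms(1) by fastforce
    have "mp_degree p \<in> insert 0 (mon_degree ` Poly_Mapping.keys p)"
      unfolding mp_degree_def by (rule Max_in) auto
    then show ?thesis using mon_degree_le_mp_degree[OF n] n by auto
  qed
  then obtain m where m: "m \<in> Poly_Mapping.keys p" "mon_degree m = mp_degree p" by blast
  have m0: "Poly_Mapping.lookup m v0 = 0" using assms(2) m by (simp add: var_free_def)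
  have "n + Poly_Mapping.single v0 (mp_degree p - mon_degree n) = m \<longleftrightarrow> n = m"
    if "n \<in> Poly_Mapping.keys p" for n
  proof
    assume *: "n + Poly_Mapping.single v0 (mp_degree p - mon_degree n) = m"
    then have "Poly_Mapping.lookup (n + Poly_Mapping.single v0 (mp_degree p - mon_degree n)) v0 = 0"
      using m0 by simp
    then have "mp_degree p - mon_degree n = 0" by (simp add: lookup_add)
    with * show "n = m" by simp
  qed (use m in simp)
  then have "Poly_Mapping.lookup (mp_homogenize v0 p) m
      = (\<Sum>n\<in>Poly_Mapping.keys p. if n = m then Poly_Mapping.lookup p n else 0)"
    unfolding mp_homogenize_def lookup_sum
    by (intro sum.cong) (auto simp: lookup_single when_def)
  also have "\<dots> = Poly_Mapping.lookup p m" using m by simp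
  finally have "m \<in> Poly_Mapping.keys (mp_homogenize v0 p)" using m by (simp add: in_keys_iff)
  then show ?thesis using m0 by blast
qed

text \<open>A factor that is a multiple of the variable \<open>v0\<close> would put
  \<open>v0\<close> into every monomial of the homogenization.\<close>

lemma infinity_not_factor:
  fixes p :: "('v::finite, 'a::field) mpoly"
  assumes "p \<noteq> 0" "var_free v0 p"
    and "Poly_Mapping.map to_ac (mp_homogenize v0 p) = (\<Sum>v\<in>UNIV. mp_const (a v) * mp_var v) * R"
  shows "\<exists>j. j \<noteq> v0 \<and> a j \<noteq> 0"
proof (rule ccontr)
  assume "\<not> ?thesis"
  then have "(\<Sum>v\<in>UNIV. mp_const (a v) * mp_var v) = (\<Sum>v\<in>{v0}. mp_const (a v) * mp_var v)"
    by (intro sum.mono_neutral_right) (auto simp: mp_const_def)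
  also have "\<dots> = Poly_Mapping.single (Poly_Mapping.single v0 1) (a v0)"
    by (simp add: mp_const_def mp_var_def mult_single)
  finally have "Poly_Mapping.keys (mp_homogenize v0 p)
      = Poly_Mapping.keys (Poly_Mapping.single (Poly_Mapping.single v0 1) (a v0) * R)"
    using assms(3) by (metis keys_map_to_ac)
  also have "\<dots> \<subseteq> {m + n | m n. m \<in> Poly_Mapping.keys (Poly_Mapping.single (Poly_Mapping.single v0 (1::nat)) (a v0))
          \<and> n \<in> Poly_Mapping.keys R}"
    by (rule keys_mult)
  finally have "Poly_Mapping.lookup m v0 \<noteq> 0" if "m \<in> Poly_Mapping.keys (mp_homogenize v0 p)" for m
    using that by (auto simp: lookup_add split: if_splits)
  then show False using homogenize_has_key_without_var[OF assms(1,2)] by blast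
qed

context coeff_hom
begin

lemma hom_triple: "(\<lambda>i. mp_hom h \<sigma> (triple x y z i)) = triple (mp_hom h \<sigma> x) (mp_hom h \<sigma> y) (mp_hom h \<sigma> z)"
  by (simp add: fun_eq_iff triple_def)

lemma hom_S_affine:
  "mp_hom h v (S_affine f1 f2 f3) =
     (v 1 - v 4) * (mp_hom h (triple (v 4) (v 5) (v 6)) f3 - mp_hom h (triple (v 1) (v 2) (v 3)) f3)
   + (v 2 - v 5) * (mp_hom h (triple (v 4) (v 5) (v 6)) f2 - mp_hom h (triple (v 1) (v 2) (v 3)) f2)
   + (v 3 - v 6) * (mp_hom h (triple (v 4) (v 5) (v 6)) f1 - mp_hom h (triple (v 1) (v 2) (v 3)) f1)"
  by (simp add: S_affine_def S_diff_def hom_add hom_mult hom_diff hom_var hom_subst hom_triple)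

end

lemma S_affine_rational_zero:
  fixes f1 f2 f3 :: "(3, 'a::{field,finite}) mpoly"
  assumes "splits_into_four_hyperplanes (S_form f1 f2 f3)"
  shows "\<exists>v. v 0 = 1 \<and> (v 1, v 2, v 3) \<noteq> (v 4, v 5, v 6) \<and> mp_eval v (S_affine f1 f2 f3) = 0"
proof (cases "S_affine f1 f2 f3 = 0")
  \<comment> \<open>If the polynomial is zero, a linear factor may be zero, so the locale does not
    apply; but then every point off the diagonal serves.\<close>
  case True
  then show ?thesis
    by (intro exI[of _ "\<lambda>i. if i = 4 then 0 else 1"]) (simp add: mp_eval_def mp_hom_def)
next
  case False
  let ?p = "S_affine f1 f2 f3"
  let ?F = "S_form f1 f2 f3"
  obtain L :: "nat \<Rightarrow> (7, 'a alg_closure) mpoly" where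
    lin: "\<And>i. i < 4 \<Longrightarrow> linear_form (L i)" and
    F: "Poly_Mapping.map to_ac ?F = (\<Prod>i<4. L i)"
  proof -
    obtain L1 L2 L3 L4 :: "(7, 'a alg_closure) mpoly" where L:
      "linear_form L1" "linear_form L2" "linear_form L3" "linear_form L4"
      "Poly_Mapping.map to_ac ?F = L1 * L2 * L3 * L4"
      using assms unfolding splits_into_four_hyperplanes_def by blast
    show thesis
    proof (rule that[of "\<lambda>i. [L1, L2, L3, L4] ! i"])
      show "linear_form ([L1, L2, L3, L4] ! i)" if "i < 4" for i
        using that L by (auto simp: numeral_eq_Suc less_Suc_eq)
    qed (simp add: L numeral_eq_Suc lessThan_Suc mult_ac)
  qed
  have "\<forall>i. \<exists>a. i < 4 \<longrightarrow> L i = (\<Sum>v\<in>UNIV. mp_const (a v) * mp_var v) \<and>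
      (\<forall>\<sigma>. mp_hom (\<lambda>c. c) \<sigma> (L i) = pairing a \<sigma>)"
    using linear_form_eval lin unfolding pairing_def by blast
  from choice[OF this] obtain A where
    A: "\<And>i. i < 4 \<Longrightarrow> L i = (\<Sum>v\<in>UNIV. mp_const (A i v) * mp_var v)"
      "\<And>i \<sigma>. i < 4 \<Longrightarrow> mp_hom (\<lambda>c. c) \<sigma> (L i) = pairing (A i) \<sigma>"
    by blast
  let ?g = "\<lambda>f x y z. mp_hom to_ac (triple x y z) f"
  interpret split_quartic A "\<lambda>v. mp_hom to_ac v ?F" "?g f1" "?g f2" "?g f3"
  proof
    fix v :: "7 \<Rightarrow> 'a alg_closure"
    show "mp_hom to_ac v ?F = (\<Prod>i<4. pairing (A i) v)"
      unfolding mp_hom_map_to_ac[symmetric] F id.hom_prod by (rule prod.cong) (simp_all add: A(2))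
    show "mp_hom to_ac (conj_form v) ?F = mp_hom to_ac v ?F ^ CARD('a)"
      by (simp add: conj_form_def mp_hom_to_ac_card_power)
    show "mp_hom to_ac v ?F =
        (v 1 - v 4) * (?g f3 (v 4) (v 5) (v 6) - ?g f3 (v 1) (v 2) (v 3))
      + (v 2 - v 5) * (?g f2 (v 4) (v 5) (v 6) - ?g f2 (v 1) (v 2) (v 3))
      + (v 3 - v 6) * (?g f1 (v 4) (v 5) (v 6) - ?g f1 (v 1) (v 2) (v 3))" if "v 0 = 1"
      using that by (simp add: S_form_def to_ac.hom_homogenize to_ac.hom_S_affine)
  next
    fix i :: nat assume i: "i < 4"
    have "(\<Prod>j<4. L j) = L i * (\<Prod>j\<in>{..<4} - {i}. L j)"
      by (rule prod.remove) (use i in auto)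
    then have "Poly_Mapping.map to_ac (mp_homogenize 0 ?p)
        = (\<Sum>v\<in>UNIV. mp_const (A i v) * mp_var v) * (\<Prod>j\<in>{..<4} - {i}. L j)"
      using F A(1)[OF i] unfolding S_form_def by simp
    then show "\<exists>j. j \<noteq> 0 \<and> A i j \<noteq> 0"
      by (rule infinity_not_factor[OF False var_free_S_affine])
  qed
  obtain v :: "7 \<Rightarrow> 'a" where v: "v 0 = 1" "(v 1, v 2, v 3) \<noteq> (v 4, v 5, v 6)"
      "mp_hom to_ac (to_ac \<circ> v) ?F = 0"
    using rational_point by blast
  \<comment> \<open>At a rational point the value over the closure is the image of the value over
    the base field, so its vanishing descends.\<close>
  have "mp_hom to_ac (to_ac \<circ> v) ?F = to_ac (mp_eval v ?p)"
    using v(1) by (simp add: S_form_def to_ac.hom_comp id.hom_homogenize mp_eval_def)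
  then show ?thesis using v by auto
qed

section \<open>Ovoids\<close>

text \<open>The space is finite, so a maximal totally singular subspace containing \<open>W\<close>
  exists.\<close>

lemma totally_singular_subset_generator:
  fixes Q :: "'a::{field,finite} ^ 'n \<Rightarrow> 'a"
  assumes "totally_singular Q W"
  shows "\<exists>W'. quadric_generator Q W' \<and> W \<subseteq> W'"
proof -
  let ?T = "{W'. totally_singular Q W' \<and> W \<subseteq> W'}"
  have "\<exists>U\<in>?T. \<forall>U'\<in>?T. U \<subseteq> U' \<longrightarrow> U = U'"
    by (rule finite_has_maximal) (use assms in auto)
  then obtain U where U: "U \<in> ?T" "\<forall>U'\<in>?T. U \<subseteq> U' \<longrightarrow> U = U'" by (rule bexE)
  have "quadric_generator Q U"
    unfolding quadric_generator_def
  proof (intro conjI allI impI)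
    fix U' assume "totally_singular Q U' \<and> U \<subseteq> U'"
    then show "U' = U" using U by auto
  qed (use U(1) in simp)
  then show ?thesis using U(1) by auto
qed

text \<open>A generator containing the line would contain two points of the ovoid.\<close>

lemma ovoid_line_not_singular:
  fixes Q :: "'a::{field,finite} ^ 'n \<Rightarrow> 'a"
  assumes "is_ovoid Q Ov" "vec.span {v} \<in> Ov" "vec.span {w} \<in> Ov" "vec.span {v} \<noteq> vec.span {w}"
  shows "\<not> totally_singular Q (vec.span {v, w})"
proof
  assume "totally_singular Q (vec.span {v, w})"
  then obtain W where W: "quadric_generator Q W" "vec.span {v, w} \<subseteq> W"
    using totally_singular_subset_generator by blast
  have "vec.span {v} \<subseteq> W" "vec.span {w} \<subseteq> W"
    using W(2) vec.span_mono[of "{v}" "{v, w}"] vec.span_mono[of "{w}" "{v, w}"] by auto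
  then show False using assms W(1) unfolding is_ovoid_def by blast
qed

text \<open>The bilinear form \<open>Q7 (v + w) - Q7 v - Q7 w\<close>, written out so that it is
  correct in every characteristic.\<close>

definition Q7_polar :: "(8 \<Rightarrow> 'a::field) \<Rightarrow> (8 \<Rightarrow> 'a) \<Rightarrow> 'a" where
  "Q7_polar v w = v 0 * w 7 + v 7 * w 0 + v 1 * w 6 + v 6 * w 1 + v 2 * w 5 + v 5 * w 2
     + v 3 * w 4 + v 4 * w 3"

lemma Q7_combination:
  "Q7 (s *s v + t *s w) = s ^ 2 * Q7 v + t ^ 2 * Q7 w + s * t * Q7_polar (vec_nth v) (vec_nth w)"
proof -
  have *: "(s * a + t * a') * (s * b + t * b') = s ^ 2 * (a * b) + t ^ 2 * (a' * b') + s * t * (a * b' + b * a')"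
    for a a' b b'
    by (simp add: algebra_simps power2_eq_square)
  show ?thesis
    unfolding Q7_def Q7_polar_def vector_add_component vector_smult_component *
    by (simp only: distrib_left add_ac)
qed

lemma vec8_nth [simp]:
  "vec_nth (vec8 a0 a1 a2 a3 a4 a5 a6 a7) 0 = a0" "vec_nth (vec8 a0 a1 a2 a3 a4 a5 a6 a7) 1 = a1"
  "vec_nth (vec8 a0 a1 a2 a3 a4 a5 a6 a7) 2 = a2" "vec_nth (vec8 a0 a1 a2 a3 a4 a5 a6 a7) 3 = a3"
  "vec_nth (vec8 a0 a1 a2 a3 a4 a5 a6 a7) 4 = a4" "vec_nth (vec8 a0 a1 a2 a3 a4 a5 a6 a7) 5 = a5"
  "vec_nth (vec8 a0 a1 a2 a3 a4 a5 a6 a7) 6 = a6" "vec_nth (vec8 a0 a1 a2 a3 a4 a5 a6 a7) 7 = a7"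
  by (simp_all add: vec8_def)

lemma S_affine_zero_imp_not_ovoid:
  fixes f1 f2 f3 :: "(3, 'a::{field,finite}) mpoly"
  assumes off: "(v 1, v 2, v 3) \<noteq> (v 4, v 5, v 6)" and zero: "mp_eval v (S_affine f1 f2 f3) = 0"
  shows "\<not> is_ovoid Q7 (O7 f1 f2 f3)"
proof
  assume ovoid: "is_ovoid Q7 (O7 f1 f2 f3)"
  define P where "P x y z = vec8 1 x y z
    (mp_eval (triple x y z) f1) (mp_eval (triple x y z) f2) (mp_eval (triple x y z) f3)
    (- z * mp_eval (triple x y z) f1 - y * mp_eval (triple x y z) f2
       - x * mp_eval (triple x y z) f3)" for x y z
  have in_O7: "vec.span {P x y z} \<in> O7 f1 f2 f3" for x y z
    unfolding O7_def P_def by blast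
  let ?a = "P (v 1) (v 2) (v 3)" and ?b = "P (v 4) (v 5) (v 6)"
  have "vec.span {?a} \<noteq> vec.span {?b}"
  proof
    assume "vec.span {?a} = vec.span {?b}"
    then have "?a \<in> vec.span {?b}" using vec.span_base by blast
    then obtain c where c: "?a = c *s ?b" by (auto simp: vec.span_singleton)
    \<comment> \<open>Both representatives have first coordinate 1, which fixes the scalar.\<close>
    from arg_cong[OF c, of "\<lambda>x. vec_nth x 0"] have "c = 1" by (simp add: P_def)
    with c have "vec_nth ?a i = vec_nth ?b i" for i by simp
    from this[of 1] this[of 2] this[of 3] show False using off by (simp add: P_def)
  qed
  then have "\<not> totally_singular Q7 (vec.span {?a, ?b})"
    using ovoid_line_not_singular[OF ovoid in_O7 in_O7] by blast
  moreover have "totally_singular Q7 (vec.span {?a, ?b})"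
    unfolding totally_singular_def
  proof (intro conjI ballI)
    fix w assume "w \<in> vec.span {?a, ?b}"
    then obtain s t where w: "w = s *s ?a + t *s ?b"
      by (auto simp: vec.span_insert vec.span_singleton algebra_simps)
    have Q: "Q7 (P x y z) = 0" for x y z
      unfolding Q7_def P_def vec8_nth by (simp add: algebra_simps)
    \<comment> \<open>This identity is where the hypersurface comes from: its affine equation
      expresses orthogonality of two points of \<open>O7\<close>.\<close>
    have "Q7_polar (vec_nth ?a) (vec_nth ?b)
        = mp_eval v (S_affine f1 f2 f3)"
      unfolding Q7_polar_def P_def vec8_nth mp_eval_def id.hom_S_affine by (simp add: algebra_simps)
    then show "Q7 w = 0" unfolding w Q7_combination by (simp add: Q zero)
  qed (rule vec.subspace_span)
  ultimately show False by blast
qed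

theorem theorem5p1:
  fixes f1 f2 f3 :: "(3, 'a::{field,finite}) mpoly"
  assumes "real CARD('a) > 6.3 * 4 powr (13 / 3)"
    and "mp_degree f1 = 3" and "mp_degree f2 = 3" and "mp_degree f3 = 3"
    and "mp_eval (triple 0 0 0) f1 = 0"
    and "mp_eval (triple 0 0 0) f2 = 0"
    and "mp_eval (triple 0 0 0) f3 = 0"
    and "splits_into_four_hyperplanes (S_form f1 f2 f3)"
  shows "\<not> is_ovoid Q7 (O7 f1 f2 f3)"
  using S_affine_rational_zero[OF assms(8)] S_affine_zero_imp_not_ovoid by blast

end
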